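(* Conditionally on $\boldsymbol m$, for every vertex-labelled multigraph $G$ on the vertex set $[n]$, $$\mathbb{P}_m\big(\mathrm{PA}^{(D)}_n(\boldsymbol m,\delta)= G\big)=\mathbb{P}_m\big(\mathrm{PU}^{(\mathrm{NSL})}_n(\boldsymbol m,\boldsymbol\psi)= G\big),$$ where equality with $G$ means equality as vertex-labelled multigraphs, $\mathrm{PA}^{(D)}_n(\boldsymbol m,\delta)$ is preferential attachment model (D), and $\mathrm{PU}^{(\mathrm{NSL})}_n(\boldsymbol m,\boldsymbol\psi)$ is the Pólya urn graph without self-loops.
   Context: $\mathbb{N}=\{1,2,\dots\}$. $M$ is an $\mathbb{N}$-valued random variable with $\mathbb E[M^p]<\infty$ for some $p>1$, and $\delta>-\inf\operatorname{supp}(M)$. $(m_i)_{i\ge3}$ are i.i.d. copies of $M$, $m_1=m_2=1$, $\boldsymbol m=(m_1,m_2,\dots)$, $m_{[l]}=\sum_{i\le l}m_i$, and $\mathbb P_m$ is the conditional law given $\boldsymbol m$. $G_0$ is a fixed initial multigraph on $\{1,2\}$ with degrees $a_1,a_2$ with $a_i+\delta>0$, and $a_{[2]}=a_1+a_2$. **Model (D).** Starting from $G_0$, vertices $v=3,4,\dots,n$ arrive successively, vertex $v$ with $m_v$ edges attached one at a time. If $d_u(v,j-1)$ is the degree of $u$ after the first $j-1$ edges of $v$ have been attached, then the $j$-th edge of $v$ attaches to $u\in[v-1]$ with conditional probability $\frac{d_u(v,j-1)+\delta}{c_{v,j}}$, where $c_{v,j}=a_{[2]}+2(m_{[v-1]}-2)+(j-1)+(v-1)\delta$.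 **Pólya urn graph (NSL).** Given $\boldsymbol m$, let $\psi_1=1$, $\psi_2\sim\mathrm{Beta}(a_2+\delta,a_1+\delta)$ and, for $v\ge3$, $$\psi_v\sim\mathrm{Beta}\big(m_v+\delta,\ a_{[2]}+2(m_{[v-1]}-2)+m_v+(v-1)\delta\big),$$ all conditionally independent. Let $\mathcal S_0=0$, $\mathcal S_k=\prod_{i=k+1}^{n}(1-\psi_i)$ for $1\le k\le n$ (so $\mathcal S_n=1$), and $\mathcal I_k=[\mathcal S_{k-1},\mathcal S_k)$. Let $(U_s)_{s\ge1}$ be i.i.d. uniform on $[0,1]$, independent of $\boldsymbol\psi$. The graph $\mathrm{PU}^{(\mathrm{NSL})}_n(\boldsymbol m,\boldsymbol\psi)$ on $[n]$ consists of $G_0$ on $\{1,2\}$ together with, for each $k\in\{3,\dots,n\}$ and $j\in[m_k]$, an edge from $k$ to the vertex $u\in[k-1]$ for which $U_{m_{[k-1]}+j}\,\mathcal S_{k-1}\in\mathcal I_u$. *)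

theory Defs
  imports "HOL-Probability.Probability" "HOL-Library.Uprod"
begin

section \<open>Vertex-labelled multigraphs\<close>

text \<open>A multigraph is its multiset of edges; an edge is an unordered pair \<^term>\<open>Upair u v\<close>,
  a self-loop being \<^term>\<open>Upair u u\<close>. The vertex set \<open>{1..n}\<close> is given separately.\<close>

type_synonym multigraph = "nat uprod multiset"

definition multigraph_on :: "nat set \<Rightarrow> multigraph \<Rightarrow> bool" where
  "multigraph_on V G \<longleftrightarrow> (\<forall>e\<in>#G. set_uprod e \<subseteq> V)"

definition incidence :: "nat \<Rightarrow> nat uprod \<Rightarrow> nat" where
  "incidence u e = (if u \<notin> set_uprod e then 0 else if proper_uprod e then 1 else 2)"

definition degree :: "multigraph \<Rightarrow> nat \<Rightarrow> nat" where
  "degree G u = (\<Sum>e\<in>#G. incidence u e)"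

section \<open>Conditional laws\<close>

text \<open>Sequences are indexed from 1; the value at index 0 is ignored.\<close>

definition sigma_seq :: "'a measure \<Rightarrow> (nat \<Rightarrow> 'a \<Rightarrow> nat) \<Rightarrow> 'a measure" where
  "sigma_seq P m = vimage_algebra (space P) (\<lambda>\<omega>. \<lambda>i\<in>{1..}. m i \<omega>)
     (\<Pi>\<^sub>M i\<in>{1..}. count_space UNIV)"

text \<open>Conditional probability of an event given a sub-sigma-algebra; determined up to null sets.\<close>

definition prob_given :: "'a measure \<Rightarrow> 'a measure \<Rightarrow> 'a set \<Rightarrow> 'a \<Rightarrow> real" where
  "prob_given P F A = real_cond_exp P F (indicator A)"

definition has_cond_law ::
  "'a measure \<Rightarrow> 'a measure \<Rightarrow> ('a \<Rightarrow> 'b) \<Rightarrow> 'b measure \<Rightarrow> ('a \<Rightarrow> 'b measure) \<Rightarrow> bool" where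
  "has_cond_law P F X N K \<longleftrightarrow> X \<in> measurable P N \<and>
     (\<forall>B\<in>sets N. AE \<omega> in P. prob_given P F (X -` B \<inter> space P) \<omega> = measure (K \<omega>) B)"

section \<open>Preferential attachment, model (D)\<close>

definition psum :: "(nat \<Rightarrow> nat) \<Rightarrow> nat \<Rightarrow> nat" where
  "psum m l = (\<Sum>i=1..l. m i)"

definition init_degree :: "multigraph \<Rightarrow> nat" where
  "init_degree G0 = degree G0 1 + degree G0 2"

definition attach_norm :: "multigraph \<Rightarrow> real \<Rightarrow> (nat \<Rightarrow> nat) \<Rightarrow> nat \<Rightarrow> nat \<Rightarrow> real" where
  "attach_norm G0 \<delta> m v j =
     real (init_degree G0) + 2 * (real (psum m (v - 1)) - 2) + (real j - 1) + (real v - 1) * \<delta>"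

text \<open>For every graph \<open>H\<close> reached by the recursion below (and admissible \<open>m\<close>, \<open>\<delta>\<close>, \<open>G0\<close>) the
  weights are nonnegative and sum to 1, so that \<^const>\<open>embed_pmf\<close> is the law with these weights.\<close>

definition target_pmf ::
  "multigraph \<Rightarrow> real \<Rightarrow> (nat \<Rightarrow> nat) \<Rightarrow> nat \<Rightarrow> nat \<Rightarrow> multigraph \<Rightarrow> nat pmf" where
  "target_pmf G0 \<delta> m v j H =
     embed_pmf (\<lambda>u. if u \<in> {1..<v} then (real (degree H u) + \<delta>) / attach_norm G0 \<delta> m v j else 0)"

text \<open>Attach the first \<open>j\<close> edges of vertex \<open>v\<close> to the graph \<open>H\<close>, one at a time.\<close>

primrec attach_edges ::
  "multigraph \<Rightarrow> real \<Rightarrow> (nat \<Rightarrow> nat) \<Rightarrow> nat \<Rightarrow> nat \<Rightarrow> multigraph \<Rightarrow> multigraph pmf" where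
  "attach_edges G0 \<delta> m v 0 H = return_pmf H"
| "attach_edges G0 \<delta> m v (Suc j) H =
     bind_pmf (attach_edges G0 \<delta> m v j H) (\<lambda>H'.
       map_pmf (\<lambda>u. add_mset (Upair v u) H') (target_pmf G0 \<delta> m v (Suc j) H'))"

primrec PA_D :: "multigraph \<Rightarrow> real \<Rightarrow> (nat \<Rightarrow> nat) \<Rightarrow> nat \<Rightarrow> multigraph pmf" where
  "PA_D G0 \<delta> m 0 = return_pmf G0"
| "PA_D G0 \<delta> m (Suc n) =
     (if Suc n \<le> 2 then return_pmf G0
      else bind_pmf (PA_D G0 \<delta> m n) (attach_edges G0 \<delta> m (Suc n) (m (Suc n))))"

section \<open>Polya urn graph without self-loops\<close>

definition beta_measure :: "real \<Rightarrow> real \<Rightarrow> real measure" where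
  "beta_measure a b = density lborel
     (\<lambda>x. ennreal (indicator {0<..<1} x * (x powr (a - 1) * (1 - x) powr (b - 1) / Beta a b)))"

definition psi_law :: "multigraph \<Rightarrow> real \<Rightarrow> (nat \<Rightarrow> nat) \<Rightarrow> nat \<Rightarrow> real measure" where
  "psi_law G0 \<delta> m v =
     (if v \<le> 1 then return borel 1
      else if v = 2 then beta_measure (real (degree G0 2) + \<delta>) (real (degree G0 1) + \<delta>)
      else beta_measure (real (m v) + \<delta>)
        (real (init_degree G0) + 2 * (real (psum m (v - 1)) - 2) + real (m v) + (real v - 1) * \<delta>))"

text \<open>Joint law of \<open>(\<psi>\<^sub>v)\<close> and \<open>(U\<^sub>s)\<close> given \<open>m\<close>: all coordinates independent.\<close>

definition urn_law ::
  "multigraph \<Rightarrow> real \<Rightarrow> (nat \<Rightarrow> nat) \<Rightarrow> ((nat \<Rightarrow> real) \<times> (nat \<Rightarrow> real)) measure" where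
  "urn_law G0 \<delta> m =
     (\<Pi>\<^sub>M v\<in>{1..}. psi_law G0 \<delta> m v) \<Otimes>\<^sub>M (\<Pi>\<^sub>M s\<in>{1..}. uniform_measure lborel {0..1})"

definition urn_pos :: "nat \<Rightarrow> (nat \<Rightarrow> real) \<Rightarrow> nat \<Rightarrow> real" where
  "urn_pos n \<psi> k = (if k = 0 then 0 else (\<Prod>i=k+1..n. 1 - \<psi> i))"

text \<open>The vertex \<open>u\<close> is almost surely unique and existent; its arbitrary value on the
  exceptional null event (e.g. \<open>x = 1\<close>) is irrelevant.\<close>

definition urn_target :: "nat \<Rightarrow> (nat \<Rightarrow> real) \<Rightarrow> nat \<Rightarrow> real \<Rightarrow> nat" where
  "urn_target n \<psi> k x =
     (THE u. u \<in> {1..k-1} \<and> x * urn_pos n \<psi> (k - 1) \<in> {urn_pos n \<psi> (u - 1)..<urn_pos n \<psi> u})"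

definition PU_NSL ::
  "multigraph \<Rightarrow> nat \<Rightarrow> (nat \<Rightarrow> nat) \<Rightarrow> (nat \<Rightarrow> real) \<Rightarrow> (nat \<Rightarrow> real) \<Rightarrow> multigraph" where
  "PU_NSL G0 n m \<psi> U = G0 +
     (\<Sum>k\<in>{3..n}. \<Sum>j\<in>{1..m k}. {#Upair k (urn_target n \<psi> k (U (psum m (k - 1) + j)))#})"

end

theory Submission
  imports Defs
begin

text \<open>Given \<open>m\<close> and \<open>\<psi>\<close>, the urn edges are independent, an edge of \<open>v\<close> choosing \<open>t\<close> with probability
  \<open>\<psi>\<^sub>t \<Prod>\<^sub>t\<^sub><\<^sub>u\<^sub><\<^sub>v (1 - \<psi>\<^sub>u)\<close>. Beta laws are conjugate to these weights: revealing an edge from \<open>v\<close> to \<open>t\<close> raises the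
  first parameter of \<open>\<psi>\<^sub>t\<close> and the second parameters of the \<open>\<psi>\<^sub>u\<close> with \<open>t < u < v\<close> by one. Hence the posterior
  parameters are functions of the current graph, namely \<open>D\<^sub>u\<close> and \<open>\<Sum>\<^sub>i\<^sub><\<^sub>u D\<^sub>i\<close> with \<open>D\<^sub>u\<close> the degree of \<open>u\<close> plus
  \<open>\<delta>\<close> (the prior of \<open>\<psi>\<^sub>u\<close> is this at the moment when \<open>u\<close> has sent out its \<open>m\<^sub>u\<close> edges), and the mean of the weight of \<open>t\<close> telescopes to \<open>D\<^sub>t / \<Sum>\<^sub>i\<^sub><\<^sub>v D\<^sub>i\<close>, the attachment probability of
  model (D). This goes by induction over the edges, the claim being strengthened to the joint law of
  the graph and all mixed moments of \<open>\<psi>\<close>.\<close>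

section \<open>Beta laws and products of probability spaces\<close>

text \<open>The joint law of the coordinates is the product measure, whose marginals are the
  \<open>M i\<close>, and independence is exactly this product form. That characterisation needs a
  nonempty index set, hence the case split.\<close>

lemma indep_vars_PiM_coordinates:
  assumes "\<And>i. i \<in> I \<Longrightarrow> prob_space (M i)"
  shows "prob_space.indep_vars (PiM I M) M (\<lambda>i x. x i) I"
proof -
  interpret prob_space "PiM I M" by (intro prob_space_PiM assms)
  show ?thesis
  proof (cases "I = {}")
    case False
    have "distr (PiM I M) (PiM I M) (\<lambda>x. \<lambda>i\<in>I. x i) = distr (PiM I M) (PiM I M) (\<lambda>x. x)"
      by (intro distr_cong) (auto simp: space_PiM)
    also have "\<dots> = (\<Pi>\<^sub>M i\<in>I. distr (PiM I M) (M i) (\<lambda>x. x i))"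
      using assms by (simp add: distr_PiM_component distr_id cong: PiM_cong)
    finally show ?thesis
      using False by (subst indep_vars_iff_distr_eq_PiM') auto
  next
    case True
    then show ?thesis
      unfolding indep_vars_def2 indep_sets_def by auto
  qed
qed

section \<open>Moments of Beta laws and the telescoping product\<close>

lemma Beta_real_pos: "a > 0 \<Longrightarrow> b > 0 \<Longrightarrow> Beta a b > (0::real)"
  by (simp add: Beta_def Gamma_real_pos)

text \<open>The monomial merges with the density into the unnormalised Beta density with parameters
  \<open>a + i\<close> and \<open>b + j\<close>. A nonnegative integral is used so that
  \<open>i = j = 0\<close> yields the total mass.\<close>

lemma nn_integral_beta_measure:
  assumes "a > 0" "b > 0"
  shows "(\<integral>\<^sup>+x. ennreal (x ^ i * (1 - x) ^ j) \<partial>beta_measure a b) =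
           ennreal (Beta (a + i) (b + j) / Beta a b)"
proof -
  have B: "Beta a b > 0"
    using assms by (simp add: Beta_real_pos)
  let ?f = "\<lambda>x. x powr (a + i - 1) * (1 - x) powr (b + j - 1) / Beta a b"
  have "((\<lambda>t. t powr (a + i - 1) * (1 - t) powr (b + j - 1)) has_integral Beta (a + i) (b + j)) {0<..<1}"
    using has_integral_Beta_real[of "a + i" "b + j"] assms by (simp add: has_integral_Icc_iff_Ioo)
  then have "(?f has_integral Beta (a + i) (b + j) / Beta a b) {0<..<1}"
    by (rule has_integral_divide)
  then have I: "(\<integral>\<^sup>+x. ennreal (indicator {0<..<1} x * ?f x) \<partial>lborel) = ennreal (Beta (a + i) (b + j) / Beta a b)"
    using B by (intro nn_integral_has_integral_lebesgue) auto
  have "(\<integral>\<^sup>+x. ennreal (x ^ i * (1 - x) ^ j) \<partial>beta_measure a b) =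
      (\<integral>\<^sup>+x. ennreal (indicator {0<..<1} x * (x powr (a - 1) * (1 - x) powr (b - 1) / Beta a b)) *
          ennreal (x ^ i * (1 - x) ^ j) \<partial>lborel)"
    unfolding beta_measure_def by (subst nn_integral_density) auto
  also have "\<dots> = (\<integral>\<^sup>+x. ennreal (indicator {0<..<1} x * ?f x) \<partial>lborel)"
  proof (intro nn_integral_cong)
    fix x :: real
    show "ennreal (indicator {0<..<1} x * (x powr (a - 1) * (1 - x) powr (b - 1) / Beta a b)) *
          ennreal (x ^ i * (1 - x) ^ j) = ennreal (indicator {0<..<1} x * ?f x)"
    proof (cases "x \<in> {0<..<1}")
      case True
      then have "x powr (a + i - 1) = x powr (a - 1) * x ^ i"
        "(1 - x) powr (b + j - 1) = (1 - x) powr (b - 1) * (1 - x) ^ j"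
        by (simp_all add: powr_add[symmetric] powr_realpow[symmetric] algebra_simps)
      with True B show ?thesis
        by (subst ennreal_mult[symmetric]) (auto intro!: arg_cong[where f = ennreal])
    qed auto
  qed
  finally show ?thesis using I by simp
qed

lemma sets_beta_measure [measurable_cong, simp]: "sets (beta_measure a b) = sets borel"
  and space_beta_measure [simp]: "space (beta_measure a b) = UNIV"
  by (simp_all add: beta_measure_def)

lemma prob_space_beta_measure:
  assumes "a > 0" "b > 0"
  shows "prob_space (beta_measure a b)"
proof
  have "Beta a b > 0"
    using assms by (simp add: Beta_real_pos)
  then show "emeasure (beta_measure a b) (space (beta_measure a b)) = 1"
    using nn_integral_beta_measure[OF assms, of 0 0] by (simp del: space_beta_measure)
qed

lemma AE_beta_measure: "AE x in beta_measure a b. 0 < x \<and> x < 1"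
  unfolding beta_measure_def by (subst AE_density) (auto simp: indicator_def)

lemma integral_beta_measure:
  assumes "a > 0" "b > 0"
  shows "(\<integral>x. x ^ i * (1 - x) ^ j \<partial>beta_measure a b) = Beta (a + i) (b + j) / Beta a b"
proof (rule integral_eq_nn_integral[THEN trans])
  show "AE x in beta_measure a b. 0 \<le> x ^ i * (1 - x) ^ j"
    using AE_beta_measure[of a b] by eventually_elim auto
  show "enn2real (\<integral>\<^sup>+x. ennreal (x ^ i * (1 - x) ^ j) \<partial>beta_measure a b) =
      Beta (a + i) (b + j) / Beta a b"
    using assms by (subst nn_integral_beta_measure) (auto simp: Beta_real_pos less_imp_le)
qed auto

text \<open>This is the mean of a Beta(\<open>a\<close>, \<open>b\<close>) variable, from the
  recursion of the Beta function in its first argument.\<close>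

lemma Beta_plus1_left_ratio:
  assumes "a > 0" "b > (0::real)"
  shows "Beta (a + 1) b / Beta a b = a / (a + b)"
proof -
  have "Beta a b > 0" using assms by (simp add: Beta_real_pos)
  moreover have "(a + b) * Beta (a + 1) b = a * Beta a b"
    by (rule Beta_plus1_left) (use assms in \<open>auto dest: nonpos_Ints_nonpos\<close>)
  ultimately show ?thesis using assms by (simp add: field_simps)
qed

lemma Beta_plus1_right_ratio:
  assumes "a > 0" "b > (0::real)"
  shows "Beta a (b + 1) / Beta a b = b / (a + b)"
  using Beta_plus1_left_ratio[OF assms(2,1)] by (simp add: Beta_commute add.commute)

text \<open>Let C(u) be the sum of \<open>D\<close> below u. Factors with u < t equal 1, the factor
  at t is D(t) / C(t+1), and each later one is C(u) / C(u+1), so the product telescopes. For t = 1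
  there is no factor at t, but C(2) = D(1).\<close>

lemma prod_Beta_ratio_telescope:
  fixes D :: "nat \<Rightarrow> real"
  assumes "v \<ge> 2" "1 \<le> t" "t < v" "\<And>u. 1 \<le> u \<Longrightarrow> u < v \<Longrightarrow> D u > 0"
  shows "(\<Prod>u\<in>{2..<v}. Beta (D u + of_bool (u = t)) ((\<Sum>i\<in>{1..<u}. D i) + of_bool (t < u)) /
            Beta (D u) (\<Sum>i\<in>{1..<u}. D i)) = D t / (\<Sum>i\<in>{1..<v}. D i)"
  using assms
proof (induction v rule: dec_induct)
  case base
  have "{1..<2::nat} = {1}" by auto
  moreover have "t = 1" using base by simp
  ultimately show ?case using base(3)[of 1] by simp
next
  case (step v)
  let ?C = "\<lambda>v. \<Sum>i\<in>{1..<v}. D i"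
  have C: "?C v > 0" by (rule sum_pos) (use step in auto)
  have Dv: "D v > 0" using step by auto
  have S: "?C (Suc v) = D v + ?C v" using step by simp
  let ?P = "\<lambda>v. \<Prod>u\<in>{2..<v}. Beta (D u + of_bool (u = t)) (?C u + of_bool (t < u)) / Beta (D u) (?C u)"
  have P: "?P (Suc v) = ?P v * (Beta (D v + of_bool (v = t)) (?C v + of_bool (t < v)) / Beta (D v) (?C v))"
    using step by simp
  show ?case
  proof (cases "t = v")
    case True
    have "?P v = (\<Prod>u\<in>{2..<v}. 1)"
    proof (intro prod.cong refl)
      fix u assume u: "u \<in> {2..<v}"
      have "?C u > 0" by (rule sum_pos) (use step u in auto)
      then have "Beta (D u) (?C u) > 0" using step.prems(3)[of u] u by (simp add: Beta_real_pos)
      then show "Beta (D u + of_bool (u = t)) (?C u + of_bool (t < u)) / Beta (D u) (?C u) = 1"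
        using True u by auto
    qed
    then show ?thesis
      unfolding P S using True Beta_plus1_left_ratio[OF Dv C] by simp
  next
    case False
    then have "?P v = D t / ?C v" using step by auto
    then show ?thesis
      unfolding P S using False step.prems Beta_plus1_right_ratio[OF Dv C] C by simp
  qed
qed

text \<open>For a fixed result \<open>y\<close>, each choice \<open>u\<close> has at most one
  predecessor \<open>g u\<close>, and \<open>R u\<close> says whether it exists. For edge insertion,
  \<open>g\<close> deletes the edge and \<open>R\<close> tests its presence.\<close>

lemma pmf_bind_map_finite:
  assumes S: "finite S" "\<And>x. x \<in> set_pmf p \<Longrightarrow> set_pmf (t x) \<subseteq> S"
    and h: "\<And>x u. u \<in> S \<Longrightarrow> h u x = y \<longleftrightarrow> R u \<and> x = g u"
  shows "pmf (bind_pmf p (\<lambda>x. map_pmf (\<lambda>u. h u x) (t x))) y =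
    (\<Sum>u\<in>S. of_bool (R u) * (pmf p (g u) * pmf (t (g u)) u))"
proof -
  have "pmf (bind_pmf p (\<lambda>x. map_pmf (\<lambda>u. h u x) (t x))) y =
    (\<integral>x. (\<Sum>u\<in>S. of_bool (R u) * (indicator {g u} x * pmf (t (g u)) u)) \<partial>measure_pmf p)"
    unfolding pmf_bind
  proof (intro integral_cong_AE)
    show "AE x in p. pmf (map_pmf (\<lambda>u. h u x) (t x)) y =
      (\<Sum>u\<in>S. of_bool (R u) * (indicator {g u} x * pmf (t (g u)) u))"
    proof (intro AE_pmfI)
      fix x assume x: "x \<in> set_pmf p"
      have "pmf (map_pmf (\<lambda>u. h u x) (t x)) y = measure (t x) {u \<in> S. h u x = y}"
        unfolding pmf_map by (intro measure_eq_AE AE_pmfI) (use S(2)[OF x] in auto)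
      also have "\<dots> = (\<Sum>u\<in>{u \<in> S. h u x = y}. pmf (t x) u)"
        using S(1) by (simp add: measure_measure_pmf_finite)
      also have "\<dots> = (\<Sum>u\<in>S. of_bool (R u) * (indicator {g u} x * pmf (t (g u)) u))"
        using S(1) h by (intro sum.mono_neutral_cong_left) (auto simp: indicator_def)
      finally show "pmf (map_pmf (\<lambda>u. h u x) (t x)) y =
        (\<Sum>u\<in>S. of_bool (R u) * (indicator {g u} x * pmf (t (g u)) u))" .
    qed
  qed auto
  also have "\<dots> = (\<Sum>u\<in>S. of_bool (R u) * (pmf p (g u) * pmf (t (g u)) u))"
    by (subst Bochner_Integration.integral_sum)
       (auto simp: pmf.rep_eq intro!: sum.cong measure_pmf.integrable_const_bound[where B = 1])
  finally show ?thesis .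
qed

section \<open>The attachment process and the urn targets\<close>

lemma incidence_Upair: "incidence x (Upair v u) = of_bool (x = v) + of_bool (x = u)"
  by (auto simp: incidence_def)

lemma degree_add_Upair:
  "degree (add_mset (Upair v u) H) x = degree H x + of_bool (x = v) + of_bool (x = u)"
  by (simp add: degree_def incidence_Upair)

lemma degree_eq_0:
  assumes "multigraph_on V H" "u \<notin> V"
  shows "degree H u = 0"
  using assms unfolding degree_def multigraph_on_def incidence_def
  by (auto simp: subset_iff)

text \<open>The value of \<open>THE\<close>, even where the description is improper, depends only on
  the set of \<open>u\<close> in \<open>F\<close> that satisfy \<open>Q\<close>. The event is
  therefore a finite union over the possible sets.\<close>

lemma pred_THE_finite:
  assumes "finite F" and [measurable]: "\<And>u. u \<in> F \<Longrightarrow> Measurable.pred M (Q u)"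
  shows "Measurable.pred M (\<lambda>x. (THE u. u \<in> F \<and> Q u x) = t)"
proof -
  have "(THE u. u \<in> F \<and> Q u x) = t \<longleftrightarrow>
      (\<exists>S\<in>{S \<in> Pow F. (THE u. u \<in> S) = t}. \<forall>u\<in>F. u \<in> S \<longleftrightarrow> Q u x)" for x
  proof
    assume "(THE u. u \<in> F \<and> Q u x) = t"
    then show "\<exists>S\<in>{S \<in> Pow F. (THE u. u \<in> S) = t}. \<forall>u\<in>F. u \<in> S \<longleftrightarrow> Q u x"
      by (intro bexI[of _ "{u \<in> F. Q u x}"]) auto
  next
    assume "\<exists>S\<in>{S \<in> Pow F. (THE u. u \<in> S) = t}. \<forall>u\<in>F. u \<in> S \<longleftrightarrow> Q u x"
    then obtain S where S: "S \<subseteq> F" "(THE u. u \<in> S) = t" "\<forall>u\<in>F. u \<in> S \<longleftrightarrow> Q u x" by auto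
    then have "(\<lambda>u. u \<in> F \<and> Q u x) = (\<lambda>u. u \<in> S)" by auto
    with S show "(THE u. u \<in> F \<and> Q u x) = t" by simp
  qed
  moreover have "finite {S \<in> Pow F. (THE u. u \<in> S) = t}" using assms(1) by simp
  then have "Measurable.pred M (\<lambda>x. \<exists>S\<in>{S \<in> Pow F. (THE u. u \<in> S) = t}. \<forall>u\<in>F. u \<in> S \<longleftrightarrow> Q u x)"
    using assms(1) by (intro pred_intros_finite) auto
  ultimately show ?thesis by simp
qed

lemma pred_urn_target:
  assumes "\<And>k. k \<ge> 2 \<Longrightarrow> (\<lambda>x. \<Psi> x k) \<in> borel_measurable M" and [measurable]: "f \<in> borel_measurable M"
  shows "Measurable.pred M (\<lambda>x. urn_target n (\<Psi> x) v (f x) = t)"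
proof -
  have [measurable]: "(\<lambda>x. urn_pos n (\<Psi> x) k) \<in> borel_measurable M" for k
    unfolding urn_pos_def using assms(1) by (cases "k = 0") (auto intro!: borel_measurable_prod)
  show ?thesis
    unfolding urn_target_def by (intro pred_THE_finite) auto
qed

lemma sets_urn_target: "{x. urn_target n \<psi> v x = t} \<in> sets borel"
proof -
  have "Measurable.pred borel (\<lambda>x. urn_target n \<psi> v x = t)"
    by (rule pred_urn_target) auto
  then show ?thesis by (simp add: pred_def)
qed

section \<open>The urn graph revealed edge by edge\<close>

locale urn_graph =
  fixes G0 :: multigraph and m :: "nat \<Rightarrow> nat"
begin

lemma psum_Suc: "psum m (Suc k) = psum m k + m (Suc k)"
  by (simp add: psum_def)

text \<open>The urn graph truncated after the first \<open>j\<close> edges of \<open>v\<close>, in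
  the order in which model (D) attaches edges. The positions are still those of the full graph on
  [n].\<close>

definition urn_partial :: "nat \<Rightarrow> (nat \<Rightarrow> real) \<Rightarrow> (nat \<Rightarrow> real) \<Rightarrow> nat \<Rightarrow> nat \<Rightarrow> multigraph" where
  "urn_partial n \<psi> U v j = G0 +
     (\<Sum>k\<in>{3..<v}. \<Sum>i\<in>{1..m k}. {#Upair k (urn_target n \<psi> k (U (psum m (k - 1) + i)))#}) +
     (\<Sum>i\<in>{1..j}. {#Upair v (urn_target n \<psi> v (U (psum m (v - 1) + i)))#})"

lemma urn_partial_init: "urn_partial n \<psi> U 3 0 = G0"
  by (simp add: urn_partial_def)

lemma urn_partial_Suc: "urn_partial n \<psi> U v (Suc j) =
    add_mset (Upair v (urn_target n \<psi> v (U (psum m (v - 1) + Suc j)))) (urn_partial n \<psi> U v j)"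
  by (simp add: urn_partial_def)

lemma urn_partial_next_vertex:
  "v \<ge> 3 \<Longrightarrow> urn_partial n \<psi> U (Suc v) 0 = urn_partial n \<psi> U v (m v)"
  by (simp add: urn_partial_def)

lemma PU_NSL_eq_urn_partial: "n \<ge> 2 \<Longrightarrow> PU_NSL G0 n m \<psi> U = urn_partial n \<psi> U (Suc n) 0"
  by (simp add: PU_NSL_def urn_partial_def atLeastLessThanSuc_atLeastAtMost)

text \<open>Induction over the edges: the last target takes countably many values, so the event is a
  countable union. Only the uniform variables consumed so far have to be measurable, so the lemma
  also applies on products over a finite block of indices.\<close>

lemma pred_urn_partial:
  assumes \<Psi>: "\<And>k. k \<ge> 2 \<Longrightarrow> (\<lambda>x. \<Psi> x k) \<in> borel_measurable M" and "v \<ge> 3"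
    and V: "\<And>i. 1 \<le> i \<Longrightarrow> i \<le> psum m (v - 1) + j \<Longrightarrow> (\<lambda>x. V x i) \<in> borel_measurable M"
  shows "Measurable.pred M (\<lambda>x. urn_partial n (\<Psi> x) (V x) v j = H)"
  using \<open>v \<ge> 3\<close> V
proof (induction v arbitrary: j H rule: dec_induct)
  \<comment> \<open>The induction over the edges of one vertex is isolated here because both cases
    of the induction over vertices end with it.\<close>
  have edges: "Measurable.pred M (\<lambda>x. urn_partial n (\<Psi> x) (V x) v j = H)"
    if 0: "\<And>H. Measurable.pred M (\<lambda>x. urn_partial n (\<Psi> x) (V x) v 0 = H)"
    and V: "\<And>i. 1 \<le> i \<Longrightarrow> i \<le> psum m (v - 1) + j \<Longrightarrow> (\<lambda>x. V x i) \<in> borel_measurable M"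
    for v j H
    using V
  proof (induction j arbitrary: H)
    case (Suc j)
    have IH: "Measurable.pred M (\<lambda>x. urn_partial n (\<Psi> x) (V x) v j = H)" for H
      by (rule Suc.IH, rule Suc.prems) auto
    let ?s = "psum m (v - 1) + Suc j"
    have targ: "Measurable.pred M (\<lambda>x. urn_target n (\<Psi> x) v (V x ?s) = t)" for t
      by (intro pred_urn_target \<Psi> Suc.prems) auto
    \<comment> \<open>The last edge determines the earlier graph: it must occur in \<open>H\<close>,
      and deleting it must leave that graph.\<close>
    have eq: "urn_partial n (\<Psi> x) (V x) v (Suc j) = H \<longleftrightarrow> (\<exists>t. urn_target n (\<Psi> x) v (V x ?s) = t \<and>
        Upair v t \<in># H \<and> urn_partial n (\<Psi> x) (V x) v j = H - {#Upair v t#})" for x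
      by (auto simp: urn_partial_Suc)
    show ?case
      unfolding eq
      by (rule pred_intros_countable(2), rule pred_intros_logic(3)[OF targ],
          rule pred_intros_logic(3)[OF _ IH]) simp
  qed (rule 0)
  {
    case base
    show ?case
      by (rule edges) (use base.prems in \<open>auto simp: urn_partial_init\<close>)
  next
    case (step v)
    have "psum m v = psum m (v - 1) + m v"
      using psum_Suc[of "v - 1"] step by simp
    then have V: "(\<lambda>x. V x i) \<in> borel_measurable M" if "1 \<le> i" "i \<le> psum m (v - 1) + m v" for i
      using that by (intro step.prems) auto
    have "Measurable.pred M (\<lambda>x. urn_partial n (\<Psi> x) (V x) (Suc v) 0 = H)" for H
      using step V by (simp add: urn_partial_next_vertex)
    then show ?case
      by (rule edges) (use step.prems in auto)
  }
qed

text \<open>A vertex k < v reads uniform variables with index at most m_[k], which is at most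
  m_[v-1]. The truncated graph therefore ignores the variable that the next edge will read, which
  gives independence later.\<close>

lemma urn_partial_cong:
  assumes "v \<ge> 3" "\<And>i. 1 \<le> i \<Longrightarrow> i \<le> psum m (v - 1) + j \<Longrightarrow> U i = U' i"
  shows "urn_partial n \<psi> U v j = urn_partial n \<psi> U' v j"
proof -
  have "psum m (k - 1) + i \<le> psum m (v - 1) + j" if "k \<in> {3..<v}" "i \<in> {1..m k}" for k i
  proof -
    have "psum m (k - 1) + m k = psum m k"
      using psum_Suc[of "k - 1"] that by simp
    also have "psum m k \<le> psum m (v - 1)"
      unfolding psum_def using that by (intro sum_mono2) auto
    finally show ?thesis using that by simp
  qed
  then show ?thesis
    unfolding urn_partial_def using assms(2)
    by (intro arg_cong2[where f = "(+)"] refl sum.cong) auto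
qed

lemma pred_PU_NSL:
  assumes "n \<ge> 2"
  shows "Measurable.pred ((\<Pi>\<^sub>M v\<in>{1..}. borel) \<Otimes>\<^sub>M (\<Pi>\<^sub>M s\<in>{1..}. borel))
    (\<lambda>x. PU_NSL G0 n m (fst x) (snd x) = H)"
  unfolding PU_NSL_eq_urn_partial[OF assms]
proof (rule pred_urn_partial)
  fix i :: nat
  assume "1 \<le> i"
  then show "(\<lambda>x. snd x i) \<in> borel_measurable ((\<Pi>\<^sub>M v\<in>{1..}. borel) \<Otimes>\<^sub>M (\<Pi>\<^sub>M s\<in>{1..}. borel))"
    by (intro measurable_compose[OF measurable_snd measurable_component_singleton]) auto
next
  fix k :: nat
  assume "2 \<le> k"
  then show "(\<lambda>x. fst x k) \<in> borel_measurable ((\<Pi>\<^sub>M v\<in>{1..}. borel) \<Otimes>\<^sub>M (\<Pi>\<^sub>M s\<in>{1..}. borel))"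
    by (intro measurable_compose[OF measurable_fst measurable_component_singleton]) auto
qed (use assms in simp)

end

text \<open>Conditions on one deterministic realisation of the out-degrees. \<open>m_delta\<close>
  is what the lower bound on \<delta> gives for almost every realisation.\<close>

locale admissible_urn = urn_graph G0 m for G0 m +
  fixes \<delta> :: real
  assumes G0: "multigraph_on {1, 2} G0"
    and degree1: "real (degree G0 1) + \<delta> > 0" and degree2: "real (degree G0 2) + \<delta> > 0"
    and m_init: "m 1 = 1" "m 2 = 1"
    and m_delta: "\<And>v. v \<ge> 3 \<Longrightarrow> real (m v) + \<delta> > 0"
begin

section \<open>Degree invariants and the one-edge recursion of model (D)\<close>

lemma psum_2: "psum m 2 = 2"
  using m_init by (simp add: psum_def numeral_2_eq_2)

definition PA_partial :: "nat \<Rightarrow> nat \<Rightarrow> multigraph pmf" where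
  "PA_partial v j = bind_pmf (PA_D G0 \<delta> m (v - 1)) (attach_edges G0 \<delta> m v j)"

text \<open>The invariant of the recursion. Its last clause makes the attachment weights sum to 1.
  Together with \<open>degree H v = j\<close> it also identifies the prior of \<psi>_v once
  \<open>v\<close> has sent all its edges.\<close>

definition reachable :: "nat \<Rightarrow> nat \<Rightarrow> multigraph \<Rightarrow> bool" where
  "reachable v j H \<longleftrightarrow> (\<forall>u\<in>{1..<v}. real (degree H u) + \<delta> > 0) \<and> degree H v = j \<and>
     (\<forall>u>v. degree H u = 0) \<and>
     (\<Sum>u\<in>{1..<v}. real (degree H u)) =
       real (init_degree G0) + 2 * (real (psum m (v - 1)) - 2) + real j"

lemma reachable_init: "reachable 3 0 G0"
proof -
  have "{1..<3} = {1, 2::nat}" by auto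
  then show ?thesis
    using degree1 degree2 degree_eq_0[OF G0] psum_2
    by (simp add: reachable_def init_degree_def)
qed

lemma reachable_add_edge:
  assumes "reachable v j H" "u \<in> {1..<v}"
  shows "reachable v (Suc j) (add_mset (Upair v u) H)"
proof -
  have "(\<Sum>x\<in>{1..<v}. real (degree (add_mset (Upair v u) H) x)) =
      (\<Sum>x\<in>{1..<v}. real (degree H x) + of_bool (x = u))"
    by (intro sum.cong) (auto simp: degree_add_Upair)
  also have "\<dots> = (\<Sum>x\<in>{1..<v}. real (degree H x)) + 1"
    using assms(2) by (simp add: sum.distrib of_bool_def sum.delta)
  finally have "(\<Sum>x\<in>{1..<v}. real (degree (add_mset (Upair v u) H) x)) =
      (\<Sum>x\<in>{1..<v}. real (degree H x)) + 1" .
  moreover have "real (degree (add_mset (Upair v u) H) x) + \<delta> > 0" if "x \<in> {1..<v}" for x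
  proof -
    have "real (degree H x) + \<delta> > 0"
      using assms(1) that by (auto simp: reachable_def)
    moreover have "degree H x \<le> degree (add_mset (Upair v u) H) x"
      by (simp add: degree_add_Upair)
    ultimately show ?thesis by linarith
  qed
  ultimately show ?thesis
    using assms unfolding reachable_def by (simp add: degree_add_Upair)
qed

text \<open>When \<open>v\<close> joins the lower vertices, its own \<open>m v\<close> edge ends
  enter the degree total, which turns the summand \<open>m v\<close> into twice
  \<open>m v\<close>.\<close>

lemma reachable_next_vertex:
  assumes "v \<ge> 3" "reachable v (m v) H"
  shows "reachable (Suc v) 0 H"
proof -
  have "psum m v = psum m (v - 1) + m v"
    using psum_Suc[of "v - 1"] assms(1) by simp
  moreover have "{1..<Suc v} = insert v {1..<v}"
    using assms(1) by auto
  ultimately show ?thesis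
    using assms m_delta[of v] by (auto simp: reachable_def)
qed

lemma attach_norm_eq_sum:
  assumes "v \<ge> 1" "reachable v j H"
  shows "attach_norm G0 \<delta> m v (Suc j) = (\<Sum>u\<in>{1..<v}. real (degree H u) + \<delta>)"
  using assms by (simp add: attach_norm_def reachable_def sum.distrib of_nat_diff algebra_simps)

text \<open>\<open>embed_pmf\<close> has the prescribed weights once they are known to be
  nonnegative with sum 1; both facts follow from the invariant. The index \<open>Suc j\<close>
  matters: the normaliser of that edge counts the \<open>j\<close> edges already attached.\<close>

lemma pmf_target_pmf:
  assumes "v \<ge> 3" "reachable v j H"
  shows "pmf (target_pmf G0 \<delta> m v (Suc j) H) u =
    (if u \<in> {1..<v} then (real (degree H u) + \<delta>) / (\<Sum>u\<in>{1..<v}. real (degree H u) + \<delta>) else 0)"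
proof -
  let ?D = "\<lambda>u. real (degree H u) + \<delta>"
  let ?w = "\<lambda>u. if u \<in> {1..<v} then ?D u / (\<Sum>u\<in>{1..<v}. ?D u) else 0"
  have D: "?D u > 0" if "u \<in> {1..<v}" for u
    using assms(2) that by (auto simp: reachable_def)
  have S: "(\<Sum>u\<in>{1..<v}. ?D u) > 0"
    by (rule sum_pos) (use D assms in auto)
  have nonneg: "?w u \<ge> 0" for u
    using D[of u] S by auto
  have "(\<integral>\<^sup>+u. ennreal (?w u) \<partial>count_space UNIV) = (\<Sum>u\<in>{1..<v}. ennreal (?w u))"
    by (intro nn_integral_count_space') auto
  also have "\<dots> = ennreal (\<Sum>u\<in>{1..<v}. ?w u)"
    by (intro sum_ennreal nonneg)
  also have "(\<Sum>u\<in>{1..<v}. ?w u) = 1"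
    using S by (simp add: sum_divide_distrib[symmetric])
  finally have "(\<integral>\<^sup>+u. ennreal (?w u) \<partial>count_space UNIV) = 1" by simp
  then have "pmf (embed_pmf ?w) u = ?w u"
    using nonneg by (intro pmf_embed_pmf)
  moreover have "attach_norm G0 \<delta> m v (Suc j) = (\<Sum>u\<in>{1..<v}. ?D u)"
    using assms by (intro attach_norm_eq_sum) auto
  ultimately show ?thesis
    unfolding target_pmf_def by (simp only:)
qed

lemma set_target_pmf_subset:
  assumes "v \<ge> 3" "reachable v j H"
  shows "set_pmf (target_pmf G0 \<delta> m v (Suc j) H) \<subseteq> {1..<v}"
  using pmf_target_pmf[OF assms] by (auto simp: set_pmf_iff split: if_splits)

lemma attach_edges_eq:
  "attach_edges G0 \<delta> m v 0 = return_pmf"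
  "attach_edges G0 \<delta> m v (Suc j) = (\<lambda>H. bind_pmf (attach_edges G0 \<delta> m v j H)
     (\<lambda>H'. map_pmf (\<lambda>u. add_mset (Upair v u) H') (target_pmf G0 \<delta> m v (Suc j) H')))"
  by (simp_all add: fun_eq_iff)

lemma PA_partial_0: "PA_partial v 0 = PA_D G0 \<delta> m (v - 1)"
  by (simp add: PA_partial_def attach_edges_eq bind_return_pmf')

lemma PA_partial_Suc:
  "PA_partial v (Suc j) = bind_pmf (PA_partial v j)
     (\<lambda>H. map_pmf (\<lambda>u. add_mset (Upair v u) H) (target_pmf G0 \<delta> m v (Suc j) H))"
  by (simp add: PA_partial_def attach_edges_eq bind_assoc_pmf)

lemma PA_partial_init: "PA_partial 3 0 = return_pmf G0"
  by (simp add: PA_partial_0 numeral_2_eq_2)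

lemma PA_partial_next_vertex: "v \<ge> 3 \<Longrightarrow> PA_partial (Suc v) 0 = PA_partial v (m v)"
  by (cases v) (auto simp: PA_partial_def attach_edges_eq bind_return_pmf')

lemma reachable_PA_partial:
  assumes "v \<ge> 3" "H \<in> set_pmf (PA_partial v j)"
  shows "reachable v j H"
  using assms
proof (induction v arbitrary: j H rule: dec_induct)
  have edges: "\<forall>H\<in>set_pmf (PA_partial v j). reachable v j H"
    if "\<forall>H\<in>set_pmf (PA_partial v 0). reachable v 0 H" "v \<ge> 3" for v j
  proof (induction j)
    case (Suc j)
    then show ?case
      using set_target_pmf_subset[OF \<open>v \<ge> 3\<close>]
      by (fastforce simp: PA_partial_Suc intro!: reachable_add_edge)
  qed (use that in auto)
  {
    case base
    then show ?case
      using edges[of 3 j] by (auto simp: PA_partial_init reachable_init)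
  next
    case (step v)
    then have "\<forall>H\<in>set_pmf (PA_partial (Suc v) 0). reachable (Suc v) 0 H"
      by (auto simp: PA_partial_next_vertex intro!: reachable_next_vertex)
    then show ?case
      using edges[of "Suc v" j] step by auto
  }
qed

lemma pmf_PA_partial_Suc:
  assumes "v \<ge> 3"
  shows "pmf (PA_partial v (Suc j)) H = (\<Sum>u\<in>{1..<v}. of_bool (Upair v u \<in># H) *
    (pmf (PA_partial v j) (H - {#Upair v u#}) * ((real (degree (H - {#Upair v u#}) u) + \<delta>) /
       (\<Sum>i\<in>{1..<v}. real (degree (H - {#Upair v u#}) i) + \<delta>))))"
proof -
  have "pmf (PA_partial v (Suc j)) H = (\<Sum>u\<in>{1..<v}. of_bool (Upair v u \<in># H) *
    (pmf (PA_partial v j) (H - {#Upair v u#}) * pmf (target_pmf G0 \<delta> m v (Suc j) (H - {#Upair v u#})) u))"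
    unfolding PA_partial_Suc
    using set_target_pmf_subset[OF assms reachable_PA_partial[OF assms]]
    by (intro pmf_bind_map_finite) auto
  also have "\<dots> = (\<Sum>u\<in>{1..<v}. of_bool (Upair v u \<in># H) *
    (pmf (PA_partial v j) (H - {#Upair v u#}) * ((real (degree (H - {#Upair v u#}) u) + \<delta>) /
       (\<Sum>i\<in>{1..<v}. real (degree (H - {#Upair v u#}) i) + \<delta>))))"
  proof (intro sum.cong refl)
    fix u assume u: "u \<in> {1..<v}"
    let ?H = "H - {#Upair v u#}"
    show "of_bool (Upair v u \<in># H) * (pmf (PA_partial v j) ?H * pmf (target_pmf G0 \<delta> m v (Suc j) ?H) u) =
      of_bool (Upair v u \<in># H) * (pmf (PA_partial v j) ?H *
        ((real (degree ?H u) + \<delta>) / (\<Sum>i\<in>{1..<v}. real (degree ?H i) + \<delta>)))"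
    \<comment> \<open>Outside the support the invariant, and with it the weight formula, may fail,
      but then the factor \<open>pmf (PA_partial v j) ?H\<close> is zero.\<close>
    proof (cases "?H \<in> set_pmf (PA_partial v j)")
      case True
      with pmf_target_pmf[OF assms reachable_PA_partial[OF assms this]] u show ?thesis by simp
    qed (simp add: set_pmf_iff)
  qed
  finally show ?thesis .
qed

end

text \<open>The conditional probability, given \<open>\<psi>\<close>, that an edge of \<open>v\<close> attaches to \<open>t\<close>. Starting the
  product at 2 accounts for \<open>\<psi>\<^sub>1 = 1\<close>.\<close>

definition urn_weight :: "(nat \<Rightarrow> real) \<Rightarrow> nat \<Rightarrow> nat \<Rightarrow> real" where
  "urn_weight \<psi> v t = (\<Prod>u\<in>{2..<v}. \<psi> u ^ of_bool (u = t) * (1 - \<psi> u) ^ of_bool (t < u))"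

section \<open>Interval lengths and target probabilities for fixed \<psi>\<close>

lemma urn_pos_pred:
  assumes "2 \<le> k" "k \<le> n"
  shows "urn_pos n \<psi> (k - 1) = (1 - \<psi> k) * urn_pos n \<psi> k"
proof -
  have "{k..n} = insert k {k + 1..n}" using assms by auto
  then show ?thesis using assms by (simp add: urn_pos_def)
qed

text \<open>For v = t + 1 the length of I_t is \<psi>_t S_t; each increase of v moves one factor 1 -
  \<psi>_v from the position into the weight. For t = 1 the convention S_0 = 0 plays the part of
  \<psi>_1 = 1.\<close>

lemma urn_pos_diff:
  assumes "1 \<le> t" "Suc t \<le> v" "v \<le> Suc n"
  shows "urn_pos n \<psi> t - urn_pos n \<psi> (t - 1) = urn_pos n \<psi> (v - 1) * urn_weight \<psi> v t"
  using assms(2,3)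
proof (induction v rule: dec_induct)
  case base
  show ?case
  proof (cases "t = 1")
    case False
    with assms(1) have t: "t \<ge> 2" by simp
    have "urn_weight \<psi> (Suc t) t = (\<Prod>u\<in>{2..<t}. \<psi> u ^ of_bool (u = t) * (1 - \<psi> u) ^ of_bool (t < u)) * \<psi> t"
      using t by (simp add: urn_weight_def)
    also have "(\<Prod>u\<in>{2..<t}. \<psi> u ^ of_bool (u = t) * (1 - \<psi> u) ^ of_bool (t < u)) = 1"
      by (intro prod.neutral) auto
    finally show ?thesis
      using urn_pos_pred[of t n \<psi>] t base by (simp add: algebra_simps)
  qed (simp add: urn_pos_def urn_weight_def)
next
  case (step v)
  then show ?case
    using assms(1) urn_pos_pred[of v n \<psi>] by (simp add: urn_weight_def)
qed

context
  fixes n :: nat and \<psi> :: "nat \<Rightarrow> real"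
  assumes \<psi>: "\<And>v. 2 \<le> v \<Longrightarrow> v \<le> n \<Longrightarrow> 0 < \<psi> v \<and> \<psi> v < 1"
begin

lemma urn_pos_pos: "1 \<le> k \<Longrightarrow> 0 < urn_pos n \<psi> k"
  unfolding urn_pos_def using \<psi> by (auto intro!: prod_pos)

lemma urn_pos_nonneg: "0 \<le> urn_pos n \<psi> k"
  using urn_pos_pos[of k] by (cases "k = 0") (auto simp: urn_pos_def)

lemma urn_weight_nonneg: "v \<le> Suc n \<Longrightarrow> 0 \<le> urn_weight \<psi> v t"
  unfolding urn_weight_def using \<psi> by (auto intro!: prod_nonneg mult_nonneg_nonneg zero_le_power simp: less_imp_le)

lemma urn_pos_mono: "k \<le> l \<Longrightarrow> l \<le> n \<Longrightarrow> urn_pos n \<psi> k \<le> urn_pos n \<psi> l"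
proof (induction l rule: dec_induct)
  case (step l)
  have "urn_pos n \<psi> l \<le> urn_pos n \<psi> (Suc l)"
    using urn_pos_diff[of "Suc l" "Suc (Suc l)" n \<psi>] step
      mult_nonneg_nonneg[OF urn_pos_nonneg[of "Suc l"] urn_weight_nonneg[of "Suc (Suc l)" "Suc l"]]
    by simp
  with step show ?case by simp
qed simp

text \<open>The intervals below \<open>v\<close> are disjoint by monotonicity and cover [0,
  S_{v-1}), so for \<open>x < 1\<close> the description in \<open>urn_target\<close> is
  proper.\<close>

lemma urn_target_iff:
  assumes "v \<ge> 2" "v \<le> Suc n" "x \<in> {0..<1}"
  shows "urn_target n \<psi> v x = t \<longleftrightarrow> t \<in> {1..<v} \<and>
    x * urn_pos n \<psi> (v - 1) \<in> {urn_pos n \<psi> (t - 1)..<urn_pos n \<psi> t}"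
proof -
  let ?P = "\<lambda>u. u \<in> {1..v - 1} \<and> x * urn_pos n \<psi> (v - 1) \<in> {urn_pos n \<psi> (u - 1)..<urn_pos n \<psi> u}"
  have disjoint: False if "?P u" "?P u'" "u < u'" for u u'
  proof -
    have "u \<le> u' - 1" "u' - 1 \<le> n" using that assms by auto
    from urn_pos_mono[OF this] that show False by auto
  qed
  have unique: "u = u'" if "?P u" "?P u'" for u u'
    using disjoint[OF that] disjoint[OF that(2,1)] by (metis nat_neq_iff)
  \<comment> \<open>The witness is the first position beyond the point; minimality says that the
    preceding position is not beyond it.\<close>
  define u where "u = (LEAST u. x * urn_pos n \<psi> (v - 1) < urn_pos n \<psi> u)"
  have ex: "x * urn_pos n \<psi> (v - 1) < urn_pos n \<psi> (v - 1)"
    using assms urn_pos_pos[of "v - 1"] by auto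
  have u: "x * urn_pos n \<psi> (v - 1) < urn_pos n \<psi> u"
    unfolding u_def by (rule LeastI[of _ "v - 1"]) (rule ex)
  have "u \<le> v - 1"
    unfolding u_def by (rule Least_le) (rule ex)
  moreover have "u \<noteq> 0"
  proof
    assume "u = 0"
    moreover have "0 \<le> x * urn_pos n \<psi> (v - 1)"
      using assms urn_pos_nonneg[of "v - 1"] by simp
    ultimately show False
      using u by (simp add: urn_pos_def[of _ _ 0])
  qed
  moreover have "\<not> x * urn_pos n \<psi> (v - 1) < urn_pos n \<psi> (u - 1)"
    using \<open>u \<noteq> 0\<close> unfolding u_def by (intro not_less_Least) simp
  ultimately have "?P u" using u by auto
  then have "?P t \<longleftrightarrow> (THE u. ?P u) = t"
    using unique theI[of ?P u] the_equality[of ?P] by blast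
  moreover have "{1..<v} = {1..v - 1}" using assms by auto
  ultimately show ?thesis
    unfolding urn_target_def by (simp only:)
qed

text \<open>Dividing by S_{v-1} turns I_t into a subinterval of [0, 1] whose length is the weight.
  The endpoint x = 1 is discarded as a null set.\<close>

lemma measure_urn_target:
  assumes "v \<ge> 2" "v \<le> Suc n" "t \<in> {1..<v}"
  shows "measure (uniform_measure lborel {0..1}) {x. urn_target n \<psi> v x = t} = urn_weight \<psi> v t"
    (is "measure ?U ?A = _")
proof -
  let ?S = "urn_pos n \<psi>"
  have S: "?S (v - 1) > 0" using urn_pos_pos[of "v - 1"] assms by linarith
  let ?I = "{?S (t - 1) / ?S (v - 1)..<?S t / ?S (v - 1)}"
  have "0 \<le> ?S (t - 1) / ?S (v - 1)"
    using S urn_pos_nonneg[of "t - 1"] by simp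
  moreover have "?S t / ?S (v - 1) \<le> 1"
    using S urn_pos_mono[of t "v - 1"] assms by auto
  ultimately have I: "?I \<subseteq> {0..1}" by auto
  note [measurable] = sets_urn_target[of n \<psi> v t]
  have "AE x in ?U. x \<in> {0..<1}"
    by (rule AE_uniform_measureI) (use AE_lborel_singleton[of "1::real"] in auto)
  then have "measure ?U ?A = measure ?U ?I"
  proof (intro measure_eq_AE, eventually_elim)
    fix x :: real
    assume "x \<in> {0..<1}"
    then show "x \<in> ?A \<longleftrightarrow> x \<in> ?I"
      using urn_target_iff[OF assms(1,2), of x t] assms(3) S by (auto simp: field_simps)
  qed auto
  also have "\<dots> = measure lborel ({0..1} \<inter> ?I)"
    by (subst measure_uniform_measure) auto
  also have "{0..1} \<inter> ?I = ?I" using I by blast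
  also have "measure lborel ?I = (?S t - ?S (t - 1)) / ?S (v - 1)"
    using urn_pos_mono[of "t - 1" t] assms S
    by (subst measure_lborel_Ico) (auto simp: diff_divide_distrib divide_right_mono)
  also have "\<dots> = urn_weight \<psi> v t"
    using S assms by (subst urn_pos_diff[of t v]) auto
  finally show ?thesis .
qed

end

section \<open>Integrating over the urn variables\<close>

abbreviation uniform_product :: "(nat \<Rightarrow> real) measure" where
  "uniform_product \<equiv> \<Pi>\<^sub>M s\<in>{1..}. uniform_measure lborel {0..1}"

lemma prob_space_uniform_unit: "prob_space (uniform_measure lborel {0..1::real})"
  by (rule prob_space_uniform_measure) auto

lemma measurable_uniform_component:
  "i \<in> I \<Longrightarrow> (\<lambda>U. U i) \<in> borel_measurable (\<Pi>\<^sub>M i\<in>I. uniform_measure lborel {0..1::real})"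
  by (rule measurable_compose[OF measurable_component_singleton[of i]])
     (auto intro: measurable_ident_sets)

lemma prob_space_uniform_product: "prob_space uniform_product"
  by (intro prob_space_PiM prob_space_uniform_unit)

text \<open>The test functions of the induction: they are closed under multiplication by edge
  weights, and their integrals under the prior are explicit.\<close>

definition urn_moment :: "nat \<Rightarrow> (nat \<Rightarrow> nat) \<Rightarrow> (nat \<Rightarrow> nat) \<Rightarrow> (nat \<Rightarrow> real) \<Rightarrow> real" where
  "urn_moment n a b \<psi> = (\<Prod>u\<in>{2..n}. \<psi> u ^ a u * (1 - \<psi> u) ^ b u)"

lemma prod_if_less:
  fixes h :: "nat \<Rightarrow> 'a::comm_monoid_mult"
  assumes "v \<le> Suc n"
  shows "(\<Prod>u\<in>{2..n}. if u < v then h u else 1) = (\<Prod>u\<in>{2..<v}. h u)"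
  using assms by (intro prod.mono_neutral_cong_right) auto

text \<open>Conjugacy at the level of integrands: the weight of an edge is itself a monomial, so
  multiplying by it only raises exponents, and only at indices below \<open>v\<close>.\<close>

lemma urn_moment_mult_weight:
  assumes "t < v" "v \<le> Suc n"
  shows "urn_moment n a b \<psi> * urn_weight \<psi> v t =
    urn_moment n (\<lambda>u. a u + of_bool (u = t)) (\<lambda>u. b u + of_bool (t < u \<and> u < v)) \<psi>"
proof -
  have "urn_weight \<psi> v t =
      (\<Prod>u\<in>{2..n}. if u < v then \<psi> u ^ of_bool (u = t) * (1 - \<psi> u) ^ of_bool (t < u) else 1)"
    using assms(2) by (simp only: prod_if_less urn_weight_def)
  then show ?thesis
    unfolding urn_moment_def using assms(1)
    by (auto simp: prod.distrib[symmetric] power_add intro!: prod.cong)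
qed

section \<open>Prior parameters and prior moments\<close>

context admissible_urn
begin

definition prior_alpha :: "nat \<Rightarrow> real" where
  "prior_alpha v = (if v = 2 then real (degree G0 2) + \<delta> else real (m v) + \<delta>)"

definition prior_beta :: "nat \<Rightarrow> real" where
  "prior_beta v = (if v = 2 then real (degree G0 1) + \<delta> else
     real (init_degree G0) + 2 * (real (psum m (v - 1)) - 2) + real (m v) + (real v - 1) * \<delta>)"

lemma psi_law_eq: "v \<ge> 2 \<Longrightarrow> psi_law G0 \<delta> m v = beta_measure (prior_alpha v) (prior_beta v)"
  by (simp add: psi_law_def prior_alpha_def prior_beta_def)

lemma prior_alpha_pos: "v \<ge> 2 \<Longrightarrow> prior_alpha v > 0"
  using degree2 m_delta by (simp add: prior_alpha_def)

lemma prior_beta_pos: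
  assumes "v \<ge> 2"
  shows "prior_beta v > 0"
proof (cases "v = 2")
  case False
  with assms have "v \<ge> 3" by simp
  \<comment> \<open>The summand \<open>m v\<close> is dropped so that the induction closes: the
    quantity starts at a_1 + a_2 + 2\<delta> and grows by 2 m_v + \<delta> per vertex, both
    positive.\<close>
  then have "real (init_degree G0) + 2 * (real (psum m (v - 1)) - 2) + (real v - 1) * \<delta> > 0"
  proof (induction v rule: dec_induct)
    case base
    then show ?case
      using degree1 degree2 psum_2 by (simp add: init_degree_def)
  next
    case (step v)
    have "psum m v = psum m (v - 1) + m v"
      using psum_Suc[of "v - 1"] step by simp
    moreover have "2 * real (m v) + \<delta> > 0"
      using m_delta[of v] step by linarith
    ultimately show ?case
      using step by (simp add: algebra_simps)
  qed
  with False show ?thesis by (simp add: prior_beta_def)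
qed (use degree1 in \<open>simp add: prior_beta_def\<close>)

abbreviation psi_product :: "(nat \<Rightarrow> real) measure" where
  "psi_product \<equiv> \<Pi>\<^sub>M v\<in>{1..}. psi_law G0 \<delta> m v"

lemma sets_psi_law [measurable_cong]: "sets (psi_law G0 \<delta> m v) = sets borel"
  by (simp add: psi_law_def)

lemma prob_space_psi_law: "prob_space (psi_law G0 \<delta> m v)"
  by (cases "v \<ge> 2")
     (auto simp: psi_law_eq prior_alpha_pos prior_beta_pos intro!: prob_space_beta_measure,
      auto simp: psi_law_def intro!: prob_space_return)

lemma prob_space_psi_product: "prob_space psi_product"
  by (intro prob_space_PiM prob_space_psi_law)

lemma AE_psi_product: "AE \<psi> in psi_product. \<forall>v. 2 \<le> v \<longrightarrow> v \<le> n \<longrightarrow> 0 < \<psi> v \<and> \<psi> v < 1"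
proof (intro AE_all_countable[THEN iffD2] allI AE_impI)
  fix v :: nat
  assume "2 \<le> v" "v \<le> n"
  then have "AE x in psi_law G0 \<delta> m v. 0 < x \<and> x < 1"
    using AE_beta_measure by (simp only: psi_law_eq)
  then show "AE \<psi> in psi_product. 0 < \<psi> v \<and> \<psi> v < 1"
    using \<open>2 \<le> v\<close> by (intro AE_PiM_component[where P = "\<lambda>x. 0 < x \<and> x < 1"] prob_space_psi_law) auto
qed

lemma measurable_psi_component: "v \<ge> 1 \<Longrightarrow> (\<lambda>\<psi>. \<psi> v) \<in> borel_measurable psi_product"
  by (rule measurable_compose[OF measurable_component_singleton[of v]])
     (auto intro: measurable_ident_sets sets_psi_law)

lemma measurable_urn_moment [measurable]: "urn_moment n a b \<in> borel_measurable psi_product"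
  unfolding urn_moment_def
  by (intro borel_measurable_prod borel_measurable_times borel_measurable_power borel_measurable_diff
      borel_measurable_const measurable_psi_component) auto

lemma AE_urn_moment_bounds: "AE \<psi> in psi_product. 0 \<le> urn_moment n a b \<psi> \<and> urn_moment n a b \<psi> \<le> 1"
  using AE_psi_product[of n]
proof eventually_elim
  case (elim \<psi>)
  then have "0 \<le> \<psi> u ^ a u * (1 - \<psi> u) ^ b u \<and> \<psi> u ^ a u * (1 - \<psi> u) ^ b u \<le> 1" if "u \<in> {2..n}" for u
    using that by (auto intro!: mult_nonneg_nonneg mult_le_one power_le_one simp: less_imp_le)
  then show ?case
    unfolding urn_moment_def by (auto intro!: prod_nonneg prod_le_1)
qed

text \<open>The coordinates are independent, so the integral factorises into one-dimensional Beta
  moments. Integrability holds because each factor is almost surely bounded by 1.\<close>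

lemma integral_urn_moment:
  "(\<integral>\<psi>. urn_moment n a b \<psi> \<partial>psi_product) =
     (\<Prod>u\<in>{2..n}. Beta (prior_alpha u + a u) (prior_beta u + b u) / Beta (prior_alpha u) (prior_beta u))"
proof -
  interpret prob_space psi_product by (rule prob_space_psi_product)
  let ?X = "\<lambda>u x::real. x ^ a u * (1 - x) ^ b u"
  have X: "?X u \<in> borel_measurable (psi_law G0 \<delta> m u)" for u
    by measurable
  have "indep_vars (psi_law G0 \<delta> m) (\<lambda>u \<psi>. \<psi> u) {1..}"
    by (intro indep_vars_PiM_coordinates prob_space_psi_law)
  then have "indep_vars (psi_law G0 \<delta> m) (\<lambda>u \<psi>. \<psi> u) {2..n}"
    by (rule indep_vars_subset) auto
  then have ind: "indep_vars (\<lambda>_. borel) (\<lambda>u \<psi>. ?X u (\<psi> u)) {2..n}"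
    using X by (rule indep_vars_compose2)
  have int: "integrable (psi_law G0 \<delta> m u) (?X u)" if "u \<ge> 2" for u
  proof -
    interpret L: prob_space "psi_law G0 \<delta> m u" by (rule prob_space_psi_law)
    have "AE x in psi_law G0 \<delta> m u. norm (?X u x) \<le> 1"
      using AE_beta_measure unfolding psi_law_eq[OF that]
    proof eventually_elim
      case (elim x)
      then show ?case by (auto simp: abs_mult power_abs intro!: mult_le_one power_le_one)
    qed
    then show ?thesis by (rule L.integrable_const_bound) (rule X)
  qed
  have comp: "(\<lambda>\<psi>. \<psi> u) \<in> measurable psi_product (psi_law G0 \<delta> m u)" if "u \<ge> 1" for u
    using that by (intro measurable_component_singleton) auto
  have distr: "distr psi_product (psi_law G0 \<delta> m u) (\<lambda>\<psi>. \<psi> u) = psi_law G0 \<delta> m u" if "u \<ge> 1" for u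
    using that by (intro distr_PiM_component prob_space_psi_law) auto
  have "(\<integral>\<psi>. urn_moment n a b \<psi> \<partial>psi_product) = (\<Prod>u\<in>{2..n}. \<integral>\<psi>. ?X u (\<psi> u) \<partial>psi_product)"
    unfolding urn_moment_def
  proof (intro indep_vars_lebesgue_integral ind)
    fix u assume u: "u \<in> {2..n}"
    show "integrable psi_product (\<lambda>\<psi>. ?X u (\<psi> u))"
      by (rule integrable_distr[OF comp]) (use u int distr in auto)
  qed auto
  also have "\<dots> = (\<Prod>u\<in>{2..n}. Beta (prior_alpha u + a u) (prior_beta u + b u) / Beta (prior_alpha u) (prior_beta u))"
  proof (intro prod.cong refl)
    fix u assume u: "u \<in> {2..n}"
    have "(\<integral>\<psi>. ?X u (\<psi> u) \<partial>psi_product) = (\<integral>x. ?X u x \<partial>distr psi_product (psi_law G0 \<delta> m u) (\<lambda>\<psi>. \<psi> u))"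
      using u X by (subst integral_distr[OF comp]) auto
    also have "\<dots> = (\<integral>x. ?X u x \<partial>beta_measure (prior_alpha u) (prior_beta u))"
      using u by (subst distr) (auto simp: psi_law_eq)
    also have "\<dots> = Beta (prior_alpha u + a u) (prior_beta u + b u) / Beta (prior_alpha u) (prior_beta u)"
      using u by (intro integral_beta_measure prior_alpha_pos prior_beta_pos) auto
    finally show "(\<integral>\<psi>. ?X u (\<psi> u) \<partial>psi_product) =
      Beta (prior_alpha u + a u) (prior_beta u + b u) / Beta (prior_alpha u) (prior_beta u)" .
  qed
  finally show ?thesis .
qed

section \<open>Law of the truncated urn graph for fixed \<psi>, with the uniform variables
  integrated out\<close>

definition urn_prob :: "nat \<Rightarrow> nat \<Rightarrow> nat \<Rightarrow> multigraph \<Rightarrow> (nat \<Rightarrow> real) \<Rightarrow> real" where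
  "urn_prob n v j H \<psi> =
     measure uniform_product {U \<in> space uniform_product. urn_partial n \<psi> U v j = H}"

lemma sets_urn_partial:
  assumes "v \<ge> 3"
  shows "{x \<in> space (psi_product \<Otimes>\<^sub>M uniform_product). urn_partial n (fst x) (snd x) v j = H}
    \<in> sets (psi_product \<Otimes>\<^sub>M uniform_product)"
proof -
  have "(\<lambda>x. fst x k) \<in> borel_measurable (psi_product \<Otimes>\<^sub>M uniform_product)" if "k \<ge> 2" for k
    using that by (intro measurable_compose[OF measurable_fst measurable_psi_component]) auto
  moreover have "(\<lambda>x. snd x i) \<in> borel_measurable (psi_product \<Otimes>\<^sub>M uniform_product)" if "i \<ge> 1" for i
    using that by (intro measurable_compose[OF measurable_snd measurable_uniform_component]) auto
  ultimately have "Measurable.pred (psi_product \<Otimes>\<^sub>M uniform_product)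
      (\<lambda>x. urn_partial n (fst x) (snd x) v j = H)"
    by (intro pred_urn_partial assms)
  then show ?thesis by (simp add: pred_def)
qed

lemma Pair_vimage_urn_partial:
  assumes "\<psi> \<in> space psi_product"
  shows "Pair \<psi> -` {x \<in> space (psi_product \<Otimes>\<^sub>M uniform_product). urn_partial n (fst x) (snd x) v j = H}
    = {U \<in> space uniform_product. urn_partial n \<psi> U v j = H}"
  using assms by (auto simp: space_pair_measure)

text \<open>The value at \<psi> is the measure of the \<psi>-section of a jointly measurable
  event.\<close>

lemma measurable_urn_prob:
  assumes "v \<ge> 3"
  shows "urn_prob n v j H \<in> borel_measurable psi_product"
proof -
  interpret prob_space uniform_product by (rule prob_space_uniform_product)
  let ?Q = "{x \<in> space (psi_product \<Otimes>\<^sub>M uniform_product). urn_partial n (fst x) (snd x) v j = H}"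
  have "(\<lambda>\<psi>. enn2real (emeasure uniform_product (Pair \<psi> -` ?Q))) \<in> borel_measurable psi_product"
    using measurable_emeasure_Pair[OF sets_urn_partial[OF assms]] by measurable
  also have "?this \<longleftrightarrow> ?thesis"
    by (intro measurable_cong) (simp only: Pair_vimage_urn_partial urn_prob_def measure_def)
  finally show ?thesis .
qed

lemma urn_prob_bounds: "0 \<le> urn_prob n v j H \<psi>" "urn_prob n v j H \<psi> \<le> 1"
  using prob_space.prob_le_1[OF prob_space_uniform_product] by (auto simp: urn_prob_def)

text \<open>Tonelli: integrate first over the uniform variables and then over \<psi>.\<close>

lemma measure_urn_law:
  assumes "n \<ge> 2"
  shows "measure (urn_law G0 \<delta> m) {x \<in> space (urn_law G0 \<delta> m). PU_NSL G0 n m (fst x) (snd x) = H} =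
    (\<integral>\<psi>. urn_prob n (Suc n) 0 H \<psi> \<partial>psi_product)"
proof -
  interpret U: prob_space uniform_product by (rule prob_space_uniform_product)
  have n: "Suc n \<ge> 3" using assms by simp
  let ?Q = "{x \<in> space (psi_product \<Otimes>\<^sub>M uniform_product). urn_partial n (fst x) (snd x) (Suc n) 0 = H}"
  have "emeasure (psi_product \<Otimes>\<^sub>M uniform_product) ?Q =
      (\<integral>\<^sup>+\<psi>. emeasure uniform_product (Pair \<psi> -` ?Q) \<partial>psi_product)"
    by (rule U.emeasure_pair_measure_alt[OF sets_urn_partial[OF n]])
  also have "\<dots> = (\<integral>\<^sup>+\<psi>. ennreal (urn_prob n (Suc n) 0 H \<psi>) \<partial>psi_product)"
    by (intro nn_integral_cong) (simp only: Pair_vimage_urn_partial urn_prob_def U.emeasure_eq_measure)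
  finally show ?thesis
    using measurable_urn_prob[OF n, of n 0 H]
    by (subst integral_eq_nn_integral)
       (auto simp: urn_law_def measure_def PU_NSL_eq_urn_partial[OF assms] urn_prob_bounds)
qed

text \<open>Condition on the target of the last edge. For fixed \<psi>, the earlier graph depends on
  the first \<open>psum m (v - 1) + j\<close> uniform variables and the target only on the next one,
  so their probabilities multiply.\<close>

lemma urn_prob_Suc:
  assumes \<psi>: "\<And>v. 2 \<le> v \<Longrightarrow> v \<le> n \<Longrightarrow> 0 < \<psi> v \<and> \<psi> v < 1" and v: "3 \<le> v" "v \<le> n"
  shows "urn_prob n v (Suc j) H \<psi> = (\<Sum>t\<in>{1..<v}. of_bool (Upair v t \<in># H) *
    (urn_prob n v j (H - {#Upair v t#}) \<psi> * urn_weight \<psi> v t))"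
proof -
  interpret prob_space uniform_product by (rule prob_space_uniform_product)
  let ?L = "uniform_measure lborel {0..1::real}"
  let ?s = "psum m (v - 1) + j"
  let ?T = "\<lambda>U. urn_target n \<psi> v (U (Suc ?s))"
  let ?E = "\<lambda>t. {U \<in> space uniform_product. urn_partial n \<psi> U v j = H - {#Upair v t#} \<and> ?T U = t}"
  have part: "Measurable.pred (\<Pi>\<^sub>M i\<in>I. ?L) (\<lambda>U. urn_partial n \<psi> U v j = H')" if "{1..?s} \<subseteq> I" for I H'
    using that v(1) by (intro pred_urn_partial) (auto intro!: measurable_uniform_component)
  have targ: "Measurable.pred (\<Pi>\<^sub>M i\<in>I. ?L) (\<lambda>U. ?T U = t)" if "Suc ?s \<in> I" for I t
    using that by (intro pred_urn_target) (auto intro!: measurable_uniform_component)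
  have E_sets: "?E t \<in> events" for t
    using part[of "{1..}" "H - {#Upair v t#}"] targ[of "{1..}" t] by measurable
  have ind: "indep_var (\<Pi>\<^sub>M i\<in>{1..?s}. ?L) (\<lambda>U. restrict (\<lambda>i. U i) {1..?s})
      (\<Pi>\<^sub>M i\<in>{Suc ?s}. ?L) (\<lambda>U. restrict (\<lambda>i. U i) {Suc ?s})"
    by (rule indep_var_restrict[OF indep_vars_PiM_coordinates]) (auto intro: prob_space_uniform_unit)
  have E: "prob (?E t) = urn_prob n v j (H - {#Upair v t#}) \<psi> * urn_weight \<psi> v t" if t: "t \<in> {1..<v}" for t
  proof -
    let ?A = "{U \<in> space (\<Pi>\<^sub>M i\<in>{1..?s}. ?L). urn_partial n \<psi> U v j = H - {#Upair v t#}}"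
    let ?B = "{U \<in> space (\<Pi>\<^sub>M i\<in>{Suc ?s}. ?L). ?T U = t}"
    have AB: "?A \<in> sets (\<Pi>\<^sub>M i\<in>{1..?s}. ?L)" "?B \<in> sets (\<Pi>\<^sub>M i\<in>{Suc ?s}. ?L)"
      using part[of "{1..?s}"] targ[of "{Suc ?s}"] by (simp_all add: pred_def)
    have restr: "urn_partial n \<psi> (restrict (\<lambda>i. U i) {1..?s}) v j = urn_partial n \<psi> U v j" for U
      using v(1) by (intro urn_partial_cong) auto
    have spaces: "restrict (\<lambda>i. U i) {1..?s} \<in> space (\<Pi>\<^sub>M i\<in>{1..?s}. ?L)"
      "restrict (\<lambda>i. U i) {Suc ?s} \<in> space (\<Pi>\<^sub>M i\<in>{Suc ?s}. ?L)" for U :: "nat \<Rightarrow> real"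
      by (auto simp: space_PiM)
    \<comment> \<open>The event is written as the preimage of a rectangle under the two disjoint
      blocks of coordinates, the form to which independence applies.\<close>
    have "prob (?E t) = prob ((\<lambda>U. (restrict (\<lambda>i. U i) {1..?s}, restrict (\<lambda>i. U i) {Suc ?s})) -` (?A \<times> ?B)
        \<inter> space uniform_product)"
      by (intro arg_cong[where f = prob] set_eqI) (simp add: restr spaces conj_ac del: One_nat_def)
    also have "\<dots> = prob ((\<lambda>U. restrict (\<lambda>i. U i) {1..?s}) -` ?A \<inter> space uniform_product) *
        prob ((\<lambda>U. restrict (\<lambda>i. U i) {Suc ?s}) -` ?B \<inter> space uniform_product)"
      by (rule indep_varD[OF ind AB])
    also have "(\<lambda>U. restrict (\<lambda>i. U i) {1..?s}) -` ?A \<inter> space uniform_product =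
        {U \<in> space uniform_product. urn_partial n \<psi> U v j = H - {#Upair v t#}}"
      by (intro set_eqI) (simp add: restr spaces conj_ac del: One_nat_def)
    also have "(\<lambda>U. restrict (\<lambda>i. U i) {Suc ?s}) -` ?B \<inter> space uniform_product =
        (\<lambda>U. U (Suc ?s)) -` {x. urn_target n \<psi> v x = t} \<inter> space uniform_product"
      by (intro set_eqI) (simp add: spaces conj_ac del: One_nat_def)
    also have "prob \<dots> = measure (distr uniform_product ?L (\<lambda>U. U (Suc ?s))) {x. urn_target n \<psi> v x = t}"
      using sets_urn_target[of n \<psi> v t] by (subst measure_distr) auto
    also have "distr uniform_product ?L (\<lambda>U. U (Suc ?s)) = ?L"
      by (intro distr_PiM_component prob_space_uniform_unit) auto
    also have "measure ?L {x. urn_target n \<psi> v x = t} = urn_weight \<psi> v t"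
      using v t by (intro measure_urn_target \<psi>) auto
    finally show ?thesis by (simp add: urn_prob_def)
  qed
  have "AE x in ?L. x \<in> {0..<1}"
    by (rule AE_uniform_measureI) (use AE_lborel_singleton[of "1::real"] in auto)
  then have "AE U in uniform_product. U (Suc ?s) \<in> {0..<1}"
    by (intro AE_PiM_component prob_space_uniform_unit) auto
  \<comment> \<open>A uniform value below 1 has its target in \<open>{1..<v}\<close>, so up to a
    null set the event is the disjoint union of the \<open>?E t\<close> over the edges present in
    \<open>H\<close>.\<close>
  then have "urn_prob n v (Suc j) H \<psi> = prob (\<Union>t\<in>{t\<in>{1..<v}. Upair v t \<in># H}. ?E t)"
    unfolding urn_prob_def
  proof (intro measure_eq_AE, eventually_elim)
    fix U :: "nat \<Rightarrow> real" assume "U (Suc ?s) \<in> {0..<1}"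
    then have "?T U \<in> {1..<v}"
      using urn_target_iff[of n \<psi> v "U (Suc ?s)" "?T U", OF \<psi>] v by auto
    then show "U \<in> {U \<in> space uniform_product. urn_partial n \<psi> U v (Suc j) = H} \<longleftrightarrow>
        U \<in> (\<Union>t\<in>{t\<in>{1..<v}. Upair v t \<in># H}. ?E t)"
      by (auto simp: urn_partial_Suc)
  next
    have "Measurable.pred uniform_product (\<lambda>U. urn_partial n \<psi> U v (Suc j) = H)"
      using v by (intro pred_urn_partial) (auto intro!: measurable_uniform_component)
    then show "{U \<in> space uniform_product. urn_partial n \<psi> U v (Suc j) = H} \<in> events"
      by (simp add: pred_def)
  next
    show "(\<Union>t\<in>{t\<in>{1..<v}. Upair v t \<in># H}. ?E t) \<in> events"
      using E_sets by (intro sets.finite_UN) auto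
  qed
  also have "\<dots> = (\<Sum>t\<in>{t\<in>{1..<v}. Upair v t \<in># H}. prob (?E t))"
    using E_sets by (intro finite_measure_finite_Union) (auto simp: disjoint_family_on_def)
  also have "\<dots> = (\<Sum>t\<in>{t\<in>{1..<v}. Upair v t \<in># H}. urn_prob n v j (H - {#Upair v t#}) \<psi> * urn_weight \<psi> v t)"
    by (intro sum.cong refl E) auto
  also have "\<dots> = (\<Sum>t\<in>{1..<v}. of_bool (Upair v t \<in># H) *
    (urn_prob n v j (H - {#Upair v t#}) \<psi> * urn_weight \<psi> v t))"
    by (intro sum.mono_neutral_cong_left) auto
  finally show ?thesis .
qed

end

section \<open>Posterior moments and the law of the urn graph\<close>

context admissible_urn
begin

abbreviation (input) shifted_degree :: "multigraph \<Rightarrow> nat \<Rightarrow> real" where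
  "shifted_degree H u \<equiv> real (degree H u) + \<delta>"

abbreviation (input) shifted_degree_below :: "multigraph \<Rightarrow> nat \<Rightarrow> real" where
  "shifted_degree_below H u \<equiv> \<Sum>i\<in>{1..<u}. shifted_degree H i"

text \<open>Given that the urn graph after some edges of \<open>v\<close> is \<open>H\<close>, the variables \<open>\<psi>\<^sub>u\<close> with \<open>u < v\<close> are again
  independent Beta variables, whose parameters are the shifted degree of \<open>u\<close> in \<open>H\<close> and the total
  shifted degree of the vertices below \<open>u\<close>; the later ones keep their prior. The factor is the
  mixed moment of \<open>\<psi>\<^sub>u\<close> under this posterior.\<close>

definition moment_factor :: "nat \<Rightarrow> multigraph \<Rightarrow> (nat \<Rightarrow> nat) \<Rightarrow> (nat \<Rightarrow> nat) \<Rightarrow> nat \<Rightarrow> real" where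
  "moment_factor v H a b u = (if u < v
     then Beta (shifted_degree H u + a u) (shifted_degree_below H u + b u) /
       Beta (shifted_degree H u) (shifted_degree_below H u)
     else Beta (prior_alpha u + a u) (prior_beta u + b u) / Beta (prior_alpha u) (prior_beta u))"

lemma Beta_shifted_degree_pos:
  assumes "reachable v j H" "2 \<le> u" "u < v"
  shows "Beta (shifted_degree H u) (shifted_degree_below H u) > 0"
proof (rule Beta_real_pos)
  show "shifted_degree H u > 0"
    using assms by (auto simp: reachable_def)
  show "shifted_degree_below H u > 0"
    by (rule sum_pos) (use assms in \<open>auto simp: reachable_def\<close>)
qed

text \<open>Only \<psi>_2 lies below vertex 3, and its prior parameters are the shifted degrees of 2
  and 1 in \<open>G0\<close>.\<close>

lemma moment_factor_init:
  assumes "u \<ge> 2"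
  shows "moment_factor 3 G0 a b u =
    Beta (prior_alpha u + a u) (prior_beta u + b u) / Beta (prior_alpha u) (prior_beta u)"
proof (cases "u = 2")
  case True
  have "{1..<2::nat} = {1}" by auto
  with True show ?thesis by (simp add: moment_factor_def prior_alpha_def prior_beta_def)
qed (use assms in \<open>auto simp: moment_factor_def\<close>)

text \<open>Once \<open>v\<close> has sent its \<open>m v\<close> edges, its shifted degree and the
  total below it equal the prior parameters of \<psi>_v. Passing from prior to posterior form at
  \<open>u = v\<close> therefore changes nothing.\<close>

lemma moment_factor_next_vertex:
  assumes "v \<ge> 3" "reachable v (m v) H"
  shows "moment_factor (Suc v) H a b u = moment_factor v H a b u"
proof (cases "u = v")
  case True
  have "shifted_degree_below H v = prior_beta v" "shifted_degree H v = prior_alpha v"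
    using assms by (auto simp: reachable_def prior_alpha_def prior_beta_def sum.distrib of_nat_diff algebra_simps)
  with True show ?thesis by (simp add: moment_factor_def)
qed (auto simp: moment_factor_def less_Suc_eq)

text \<open>Inserting the updated Beta normaliser splits each raised moment into the ratio of new to
  old normaliser and the moment under the updated posterior. The ratios telescope to the attachment
  probability of model (D).\<close>

lemma prod_moment_factor_add_edge:
  assumes "3 \<le> v" "v \<le> n" "reachable v j H" "t \<in> {1..<v}"
  shows "(\<Prod>u\<in>{2..n}. moment_factor v H
      (\<lambda>u. a u + of_bool (u = t)) (\<lambda>u. b u + of_bool (t < u \<and> u < v)) u) =
    shifted_degree H t / shifted_degree_below H v *
      (\<Prod>u\<in>{2..n}. moment_factor v (add_mset (Upair v t) H) a b u)"
proof -
  let ?H = "add_mset (Upair v t) H"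
  let ?r = "\<lambda>u. Beta (shifted_degree H u + of_bool (u = t)) (shifted_degree_below H u + of_bool (t < u)) /
    Beta (shifted_degree H u) (shifted_degree_below H u)"
  have deg: "shifted_degree ?H u = shifted_degree H u + of_bool (u = t)" if "u < v" for u
    using that by (simp add: degree_add_Upair)
  have below: "shifted_degree_below ?H u = shifted_degree_below H u + of_bool (t < u)" if "u < v" for u
  proof -
    have "shifted_degree_below ?H u = (\<Sum>i\<in>{1..<u}. shifted_degree H i + of_bool (i = t))"
      using that by (intro sum.cong refl deg) auto
    also have "\<dots> = shifted_degree_below H u + (\<Sum>i\<in>{1..<u}. of_bool (i = t))"
      by (rule sum.distrib)
    also have "(\<Sum>i\<in>{1..<u}. of_bool (i = t)) = (of_bool (t < u) :: real)"
      using assms(4) by (simp add: of_bool_def sum.delta)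
    finally show ?thesis .
  qed
  have "moment_factor v H (\<lambda>u. a u + of_bool (u = t)) (\<lambda>u. b u + of_bool (t < u \<and> u < v)) u =
      (if u < v then ?r u else 1) * moment_factor v ?H a b u" if u: "u \<in> {2..n}" for u
  proof (cases "u < v")
    case True
    \<comment> \<open>The inserted normaliser has to be nonzero in order to cancel.\<close>
    have "Beta (shifted_degree ?H u) (shifted_degree_below ?H u) > 0"
      by (rule Beta_shifted_degree_pos[OF reachable_add_edge[OF assms(3,4)]]) (use u True in auto)
    then show ?thesis
      using True unfolding moment_factor_def
      by (simp only: deg below if_True) (simp add: ac_simps)
  next
    case False
    then show ?thesis using assms(4) by (simp add: moment_factor_def)
  qed
  then have "(\<Prod>u\<in>{2..n}. moment_factor v H
      (\<lambda>u. a u + of_bool (u = t)) (\<lambda>u. b u + of_bool (t < u \<and> u < v)) u) =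
      (\<Prod>u\<in>{2..n}. (if u < v then ?r u else 1) * moment_factor v ?H a b u)"
    by (intro prod.cong) auto
  also have "\<dots> = (\<Prod>u\<in>{2..<v}. ?r u) * (\<Prod>u\<in>{2..n}. moment_factor v ?H a b u)"
    using assms(2) by (simp only: prod.distrib prod_if_less le_SucI)
  also have "(\<Prod>u\<in>{2..<v}. ?r u) = shifted_degree H t / shifted_degree_below H v"
    using assms by (intro prod_Beta_ratio_telescope) (auto simp: reachable_def)
  finally show ?thesis .
qed

section \<open>Joint law of graph and moments, by induction over the edges\<close>

lemma integrable_urn_prob_moment:
  assumes "v \<ge> 3"
  shows "integrable psi_product (\<lambda>\<psi>. urn_prob n v j H \<psi> * urn_moment n a b \<psi>)"
proof -
  interpret prob_space psi_product by (rule prob_space_psi_product)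
  note [measurable] = measurable_urn_prob[OF assms]
  have "AE \<psi> in psi_product. norm (urn_prob n v j H \<psi> * urn_moment n a b \<psi>) \<le> 1"
    using AE_urn_moment_bounds[of n a b]
    by eventually_elim (auto simp: abs_mult urn_prob_bounds intro!: mult_le_one)
  then show ?thesis by (rule integrable_const_bound) measurable
qed

text \<open>Arbitrary exponents are required because one edge step invokes the induction hypothesis
  at raised ones. The case \<open>v = Suc n\<close>, \<open>j = 0\<close> is the completed graph; no
  edges of a vertex beyond \<open>n\<close> are treated.\<close>

lemma integral_urn_prob_moment:
  assumes "v \<ge> 3" "v \<le> n \<or> v = Suc n \<and> j = 0"
  shows "(\<integral>\<psi>. urn_prob n v j H \<psi> * urn_moment n a b \<psi> \<partial>psi_product) =
    pmf (PA_partial v j) H * (\<Prod>u\<in>{2..n}. moment_factor v H a b u)"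
  using assms
proof (induction v arbitrary: j H a b rule: dec_induct)
  have edges: "(\<integral>\<psi>. urn_prob n v j H \<psi> * urn_moment n a b \<psi> \<partial>psi_product) =
      pmf (PA_partial v j) H * (\<Prod>u\<in>{2..n}. moment_factor v H a b u)"
    if "\<And>H a b. (\<integral>\<psi>. urn_prob n v 0 H \<psi> * urn_moment n a b \<psi> \<partial>psi_product) =
      pmf (PA_partial v 0) H * (\<Prod>u\<in>{2..n}. moment_factor v H a b u)"
    and v: "3 \<le> v" and v_le: "v \<le> n \<or> v = Suc n \<and> j = 0" for v j H a b
    using v_le
  proof (induction j arbitrary: H a b)
    case (Suc j)
    then have n: "v \<le> n" by simp
    let ?e = "\<lambda>t. {#Upair v t#}"
    let ?a = "\<lambda>t u. a u + of_bool (u = t)" and ?b = "\<lambda>t u. b u + of_bool (t < u \<and> u < v)"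
    note [measurable] = measurable_urn_prob[OF v]
    have "(\<integral>\<psi>. urn_prob n v (Suc j) H \<psi> * urn_moment n a b \<psi> \<partial>psi_product) =
        (\<integral>\<psi>. (\<Sum>t\<in>{1..<v}. of_bool (Upair v t \<in># H) *
          (urn_prob n v j (H - ?e t) \<psi> * urn_moment n (?a t) (?b t) \<psi>)) \<partial>psi_product)"
    proof (rule integral_cong_AE)
      show "AE \<psi> in psi_product. urn_prob n v (Suc j) H \<psi> * urn_moment n a b \<psi> =
        (\<Sum>t\<in>{1..<v}. of_bool (Upair v t \<in># H) *
          (urn_prob n v j (H - ?e t) \<psi> * urn_moment n (?a t) (?b t) \<psi>))"
        using AE_psi_product[of n]
      proof eventually_elim
        case (elim \<psi>)
        then have eq: "urn_prob n v (Suc j) H \<psi> = (\<Sum>t\<in>{1..<v}. of_bool (Upair v t \<in># H) *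
            (urn_prob n v j (H - ?e t) \<psi> * urn_weight \<psi> v t))"
          using v n by (intro urn_prob_Suc) auto
        show ?case
          unfolding eq sum_distrib_right
          by (intro sum.cong refl) (use n in \<open>simp add: urn_moment_mult_weight[symmetric]\<close>)
      qed
    qed measurable
    also have "\<dots> = (\<Sum>t\<in>{1..<v}. of_bool (Upair v t \<in># H) *
        (\<integral>\<psi>. urn_prob n v j (H - ?e t) \<psi> * urn_moment n (?a t) (?b t) \<psi> \<partial>psi_product))"
      using integrable_urn_prob_moment[OF v]
      by (subst Bochner_Integration.integral_sum) (auto intro!: integrable_mult_right)
    also have "\<dots> = (\<Sum>t\<in>{1..<v}. of_bool (Upair v t \<in># H) * (pmf (PA_partial v j) (H - ?e t) *
        (\<Prod>u\<in>{2..n}. moment_factor v (H - ?e t) (?a t) (?b t) u)))"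
      \<comment> \<open>The induction hypothesis is applied to the graph without its last edge, with
        exponents that depend on the target \<open>t\<close>.\<close>
      using n by (simp only: Suc.IH simp_thms)
    also have "\<dots> = (\<Sum>t\<in>{1..<v}. of_bool (Upair v t \<in># H) * (pmf (PA_partial v j) (H - ?e t) *
        (shifted_degree (H - ?e t) t / shifted_degree_below (H - ?e t) v))) *
        (\<Prod>u\<in>{2..n}. moment_factor v H a b u)"
      unfolding sum_distrib_right
    proof (intro sum.cong refl)
      fix t assume t: "t \<in> {1..<v}"
      show "of_bool (Upair v t \<in># H) * (pmf (PA_partial v j) (H - ?e t) *
          (\<Prod>u\<in>{2..n}. moment_factor v (H - ?e t) (?a t) (?b t) u)) =
        of_bool (Upair v t \<in># H) * (pmf (PA_partial v j) (H - ?e t) *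
          (shifted_degree (H - ?e t) t / shifted_degree_below (H - ?e t) v)) *
          (\<Prod>u\<in>{2..n}. moment_factor v H a b u)"
      \<comment> \<open>If the edge is absent or the smaller graph has probability zero, both sides
        vanish; otherwise the invariant is available.\<close>
      proof (cases "Upair v t \<in># H \<and> H - ?e t \<in> set_pmf (PA_partial v j)")
        case True
        then show ?thesis
          using prod_moment_factor_add_edge[OF v n reachable_PA_partial[OF v] t, of "H - ?e t" j a b]
          by simp
      next
        case False
        then show ?thesis by (auto simp: set_pmf_iff)
      qed
    qed
    also have "\<dots> = pmf (PA_partial v (Suc j)) H * (\<Prod>u\<in>{2..n}. moment_factor v H a b u)"
      by (simp only: pmf_PA_partial_Suc[OF v])
    finally show ?case .
  qed (use that in simp)
  {
    case base
    show ?case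
    proof (rule edges)
      fix H a b
      interpret U: prob_space uniform_product by (rule prob_space_uniform_product)
      \<comment> \<open>Before any edge the graph is deterministic, so only the prior moment
        remains.\<close>
      have "urn_prob n 3 0 H \<psi> = of_bool (H = G0)" for \<psi>
        by (cases "H = G0") (simp_all add: urn_prob_def urn_partial_init U.prob_space del: One_nat_def)
      then show "(\<integral>\<psi>. urn_prob n 3 0 H \<psi> * urn_moment n a b \<psi> \<partial>psi_product) =
        pmf (PA_partial 3 0) H * (\<Prod>u\<in>{2..n}. moment_factor 3 H a b u)"
        by (cases "H = G0") (simp_all add: PA_partial_init integral_urn_moment moment_factor_init del: One_nat_def)
    qed (use base in auto)
  next
    case (step v)
    show ?case
    proof (rule edges)
      fix H a b
      have "urn_prob n (Suc v) 0 H \<psi> = urn_prob n v (m v) H \<psi>" for \<psi>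
        using step by (simp add: urn_prob_def urn_partial_next_vertex)
      then have "(\<integral>\<psi>. urn_prob n (Suc v) 0 H \<psi> * urn_moment n a b \<psi> \<partial>psi_product) =
        pmf (PA_partial v (m v)) H * (\<Prod>u\<in>{2..n}. moment_factor v H a b u)"
        using step by auto
      also have "\<dots> = pmf (PA_partial v (m v)) H * (\<Prod>u\<in>{2..n}. moment_factor (Suc v) H a b u)"
        using moment_factor_next_vertex[OF step(1) reachable_PA_partial[OF step(1)], of H]
        by (cases "H \<in> set_pmf (PA_partial v (m v))") (simp_all add: set_pmf_iff)
      finally show "(\<integral>\<psi>. urn_prob n (Suc v) 0 H \<psi> * urn_moment n a b \<psi> \<partial>psi_product) =
        pmf (PA_partial (Suc v) 0) H * (\<Prod>u\<in>{2..n}. moment_factor (Suc v) H a b u)"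
        using step by (simp add: PA_partial_next_vertex)
    qed (use step in auto)
  }
qed

text \<open>At exponents zero each moment factor is a Beta value divided by itself, which is 1 on
  the support of model (D); off the support both sides are zero.\<close>

lemma measure_PU_NSL_eq_pmf_PA_D:
  assumes "n \<ge> 2"
  shows "measure (urn_law G0 \<delta> m) {x \<in> space (urn_law G0 \<delta> m). PU_NSL G0 n m (fst x) (snd x) = G} =
    pmf (PA_D G0 \<delta> m n) G"
proof -
  have n: "Suc n \<ge> 3" using assms by simp
  have "(\<integral>\<psi>. urn_prob n (Suc n) 0 G \<psi> \<partial>psi_product) =
      (\<integral>\<psi>. urn_prob n (Suc n) 0 G \<psi> * urn_moment n (\<lambda>_. 0) (\<lambda>_. 0) \<psi> \<partial>psi_product)"
    by (simp add: urn_moment_def)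
  also have "\<dots> = pmf (PA_partial (Suc n) 0) G *
      (\<Prod>u\<in>{2..n}. moment_factor (Suc n) G (\<lambda>_. 0) (\<lambda>_. 0) u)"
    by (rule integral_urn_prob_moment) (use n in auto)
  also have "\<dots> = pmf (PA_partial (Suc n) 0) G"
  proof (cases "G \<in> set_pmf (PA_partial (Suc n) 0)")
    case True
    have "moment_factor (Suc n) G (\<lambda>_. 0) (\<lambda>_. 0) u = 1" if "u \<in> {2..n}" for u
      using that Beta_shifted_degree_pos[OF reachable_PA_partial[OF n True], of u]
      by (auto simp: moment_factor_def)
    then show ?thesis by simp
  qed (simp add: set_pmf_iff)
  finally show ?thesis
    by (simp add: measure_urn_law[OF assms] PA_partial_0)
qed

end

section \<open>Conditioning on the out-degrees\<close>

text \<open>Locality: the indicator of an \<open>F\<close>-measurable set can be pulled out of the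
  conditional expectation, and the two events have the same product with it.\<close>

lemma (in finite_measure_subalgebra) prob_given_cong_on:
  assumes A: "A \<in> sets F" and E: "E \<in> sets M" "E' \<in> sets M" "A \<inter> E = A \<inter> E'"
  shows "AE \<omega> in M. \<omega> \<in> A \<longrightarrow> prob_given M F E \<omega> = prob_given M F E' \<omega>"
proof -
  have "A \<in> sets M" using A subalg by (auto simp: subalgebra_def)
  have loc: "AE \<omega> in M. real_cond_exp M F (\<lambda>\<omega>. indicator A \<omega> * indicator D \<omega>) \<omega> =
      indicator A \<omega> * real_cond_exp M F (indicator D) \<omega>" if "D \<in> sets M" for D
    by (rule real_cond_exp_mult)
       (use A \<open>A \<in> sets M\<close> that in \<open>auto intro!: integrable_const_bound[where B = 1] simp: indicator_def\<close>)
  have "(\<lambda>\<omega>. indicator A \<omega> * indicator E \<omega> :: real) = (\<lambda>\<omega>. indicator A \<omega> * indicator E' \<omega>)"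
    using E(3) by (auto simp: fun_eq_iff indicator_def)
  then show ?thesis
    using loc[OF E(1)] loc[OF E(2)] by (auto simp: prob_given_def)
qed

text \<open>The graph depends on \<open>m\<close> only through its first \<open>n\<close> values, so
  countably many cases suffice when conditioning.\<close>

lemma PU_NSL_cong:
  assumes m: "\<And>i. i \<in> {1..n} \<Longrightarrow> m i = m' i"
    and \<psi>: "\<And>i. i \<ge> 1 \<Longrightarrow> \<psi> i = \<psi>' i" and U: "\<And>i. i \<ge> 1 \<Longrightarrow> U i = U' i"
  shows "PU_NSL G0 n m \<psi> U = PU_NSL G0 n m' \<psi>' U'"
proof -
  have psum: "psum m (k - 1) = psum m' (k - 1)" if "k \<in> {3..n}" for k
    unfolding psum_def using that by (intro sum.cong) (auto intro: m)
  have "urn_pos n \<psi> k = urn_pos n \<psi>' k" for k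
    unfolding urn_pos_def using \<psi> by (auto intro!: prod.cong)
  then have "urn_target n \<psi> k x = urn_target n \<psi>' k x" for k x
    by (simp add: urn_target_def)
  then show ?thesis
    unfolding PU_NSL_def using m U
    by (intro arg_cong2[where f = "(+)"] refl sum.cong) (auto simp: psum[simplified])
qed

text \<open>Lists of pairs form a countable type that covers all multigraphs, so the exceptional
  null sets can be united over all graphs.\<close>

lemma multigraph_eq_mset_pairs: "\<exists>xs. G = mset (map (\<lambda>(u, v). Upair u v) xs)"
proof (induction G)
  case (add e G)
  then obtain xs where "G = mset (map (\<lambda>(u, v). Upair u v) xs)" by blast
  moreover obtain u v where "e = Upair u v" by (cases e)
  ultimately show ?case by (intro exI[of _ "(u, v) # xs"]) simp
qed simp

lemma AE_all_multigraphs: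
  assumes "\<And>G :: multigraph. AE \<omega> in P. Q G \<omega>"
  shows "AE \<omega> in P. \<forall>G. Q G \<omega>"
proof -
  have "AE \<omega> in P. \<forall>xs. Q (mset (map (\<lambda>(u, v). Upair u v) xs)) \<omega>"
    using assms by (simp add: AE_all_countable)
  then show ?thesis
    by eventually_elim (metis multigraph_eq_mset_pairs)
qed

theorem mainTheorem4:
  fixes P :: "'a measure" and M :: "nat pmf" and p \<delta> :: real
    and m :: "nat \<Rightarrow> 'a \<Rightarrow> nat" and G0 :: multigraph and n :: nat
    and PA :: "'a \<Rightarrow> multigraph" and \<psi> U :: "nat \<Rightarrow> 'a \<Rightarrow> real"
  assumes "prob_space P"
    and "0 \<notin> set_pmf M"
    and "p > 1" and "integrable (measure_pmf M) (\<lambda>k. real k powr p)"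
    and "\<delta> > - real (Inf (set_pmf M))"
    and "\<And>\<omega>. \<omega> \<in> space P \<Longrightarrow> m 1 \<omega> = 1 \<and> m 2 \<omega> = 1"
    and "prob_space.indep_vars P (\<lambda>_. count_space UNIV) m {3..}"
    and "\<And>i. i \<ge> 3 \<Longrightarrow> distr P (count_space UNIV) (m i) = measure_pmf M"
    and "multigraph_on {1, 2} G0"
    and "real (degree G0 1) + \<delta> > 0" and "real (degree G0 2) + \<delta> > 0"
    and "n \<ge> 2"
    and "has_cond_law P (sigma_seq P m) PA (count_space UNIV)
           (\<lambda>\<omega>. measure_pmf (PA_D G0 \<delta> (\<lambda>i. m i \<omega>) n))"
    and "has_cond_law P (sigma_seq P m) (\<lambda>\<omega>. (\<lambda>v\<in>{1..}. \<psi> v \<omega>, \<lambda>s\<in>{1..}. U s \<omega>))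
           ((\<Pi>\<^sub>M v\<in>{1..}. borel) \<Otimes>\<^sub>M (\<Pi>\<^sub>M s\<in>{1..}. borel))
           (\<lambda>\<omega>. urn_law G0 \<delta> (\<lambda>i. m i \<omega>))"
  shows "AE \<omega> in P. \<forall>G. multigraph_on {1..n} G \<longrightarrow>
           prob_given P (sigma_seq P m) {\<omega>' \<in> space P. PA \<omega>' = G} \<omega> =
           prob_given P (sigma_seq P m)
             {\<omega>' \<in> space P. PU_NSL G0 n (\<lambda>i. m i \<omega>') (\<lambda>v. \<psi> v \<omega>') (\<lambda>s. U s \<omega>') = G} \<omega>"
proof -
  interpret prob_space P by fact
  define F where "F = sigma_seq P m"
  let ?N = "(\<Pi>\<^sub>M v\<in>{1..}. borel) \<Otimes>\<^sub>M (\<Pi>\<^sub>M s\<in>{1..}. borel) :: ((nat \<Rightarrow> real) \<times> (nat \<Rightarrow> real)) measure"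
  let ?X = "\<lambda>\<omega>. (\<lambda>v\<in>{1..}. \<psi> v \<omega>, \<lambda>s\<in>{1..}. U s \<omega>)"
  have m_tail: "m i \<in> measurable P (count_space UNIV)" if "i \<ge> 3" for i
    using assms(7) that by (auto simp: indep_vars_def)
  have m_P: "m i \<in> measurable P (count_space UNIV)" if "i \<ge> 1" for i
  proof -
    \<comment> \<open>Independence provides measurability only from index 3 on; the first two
      variables are constant on the space.\<close>
    from that consider "i = 1" | "i = 2" | "i \<ge> 3" by linarith
    then show ?thesis
    proof cases
      case 3
      then show ?thesis by (rule m_tail)
    qed (use assms(6) in \<open>auto simp: cong: measurable_cong\<close>)
  qed
  have m_seq: "(\<lambda>\<omega>. \<lambda>i\<in>{1..}. m i \<omega>) \<in> measurable P (\<Pi>\<^sub>M i\<in>{1..}. count_space UNIV)"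
    using m_P by (intro measurable_restrict) auto
  have "subalgebra P F"
    unfolding subalgebra_def F_def sigma_seq_def
    using sets_image_in_sets[OF refl m_seq] by simp
  then interpret finite_measure_subalgebra P F
    by unfold_locales
  have m_F: "m i \<in> measurable F (count_space UNIV)" if "i \<ge> 1" for i
  proof -
    have "(\<lambda>\<omega>. \<lambda>i\<in>{1..}. m i \<omega>) \<in> measurable F (\<Pi>\<^sub>M i\<in>{1..}. count_space UNIV)"
      unfolding F_def sigma_seq_def
      by (rule measurable_vimage_algebra1) (use m_seq in \<open>auto dest: measurable_space\<close>)
    from measurable_compose[OF this measurable_component_singleton[of i]] that
    show ?thesis by simp
  qed
  have space_F: "space F = space P"
    using \<open>subalgebra P F\<close> by (simp add: subalgebra_def)

  \<comment> \<open>Almost surely every \<open>m v\<close> lies in the support of \<open>M\<close>,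
    hence above its infimum.\<close>
  have "AE \<omega> in P. \<forall>v. v \<ge> 3 \<longrightarrow> real (m v \<omega>) + \<delta> > 0"
  proof (intro AE_all_countable[THEN iffD2] allI AE_impI)
    fix v :: nat
    assume v: "v \<ge> 3"
    have "AE k in measure_pmf M. real k + \<delta> > 0"
    proof (intro AE_pmfI)
      fix k assume k: "k \<in> set_pmf M"
      then have "Inf (set_pmf M) \<le> k" by (intro cInf_lower) auto
      then show "real k + \<delta> > 0" using assms(5) by linarith
    qed
    then have "AE k in distr P (count_space UNIV) (m v). real k + \<delta> > 0"
      by (simp only: assms(8)[OF v])
    then show "AE \<omega> in P. real (m v \<omega>) + \<delta> > 0"
      by (rule AE_distrD[OF m_tail[OF v]])
  qed
  then have admissible: "AE \<omega> in P. \<omega> \<in> space P \<and> admissible_urn G0 (\<lambda>i. m i \<omega>) \<delta>"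
    using AE_space
  proof eventually_elim
    case (elim \<omega>)
    then show ?case using assms(6)[of \<omega>] assms(9,10,11) by (auto intro!: admissible_urn.intro)
  qed

  have "AE \<omega> in P. prob_given P F {\<omega>' \<in> space P. PA \<omega>' = G} \<omega> =
      prob_given P F {\<omega>' \<in> space P. PU_NSL G0 n (\<lambda>i. m i \<omega>') (\<lambda>v. \<psi> v \<omega>') (\<lambda>s. U s \<omega>') = G} \<omega>"
    for G
  proof -
    \<comment> \<open>The map from \<open>(\<psi>, U)\<close> to the urn graph depends on \<open>m\<close>, while the conditional law only applies
      to fixed events: hence the countable split over the values \<open>c\<close> of \<open>(m\<^sub>1, \<dots>, m\<^sub>n)\<close>.\<close>
    define C where "C = PiE {1..n} (\<lambda>_. UNIV :: nat set)"
    have C: "countable C" unfolding C_def by (intro countable_PiE) auto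
    define B where "B c = {x \<in> space ?N. PU_NSL G0 n c (fst x) (snd x) = G}" for c
    have B: "B c \<in> sets ?N" for c
      using urn_graph.pred_PU_NSL[OF assms(12), of G0 c G] by (simp add: B_def pred_def)
    have X: "?X \<in> measurable P ?N"
      using assms(14) by (simp add: has_cond_law_def)
    have XB: "?X -` B c \<inter> space P \<in> sets P" for c
      using measurable_sets[OF X B] .
    define A where "A c = {\<omega> \<in> space P. \<forall>i\<in>{1..n}. m i \<omega> = c i}" for c
    have A: "A c \<in> sets F" for c
    proof -
      have "Measurable.pred F (\<lambda>\<omega>. \<forall>i\<in>{1..n}. m i \<omega> = c i)"
      proof (intro pred_intros_finite)
        fix i assume "i \<in> {1..n}"
        then have [measurable]: "m i \<in> measurable F (count_space UNIV)" by (intro m_F) auto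
        show "Measurable.pred F (\<lambda>\<omega>. m i \<omega> = c i)" by measurable
      qed auto
      then show ?thesis by (simp add: pred_def A_def space_F)
    qed
    then have AP: "A c \<in> sets P" for c
      using \<open>subalgebra P F\<close> by (auto simp: subalgebra_def)
    let ?E = "{\<omega>' \<in> space P. PU_NSL G0 n (\<lambda>i. m i \<omega>') (\<lambda>v. \<psi> v \<omega>') (\<lambda>s. U s \<omega>') = G}"
    \<comment> \<open>On \<open>A c\<close> the out-degrees are frozen at \<open>c\<close>, so the
      urn event becomes the preimage under (\<psi>, U) of a fixed measurable set.\<close>
    have AE': "A c \<inter> ?E = A c \<inter> (?X -` B c \<inter> space P)" for c
    proof -
      have "PU_NSL G0 n (\<lambda>i. m i \<omega>) (\<lambda>v. \<psi> v \<omega>) (\<lambda>s. U s \<omega>) = PU_NSL G0 n c (fst (?X \<omega>)) (snd (?X \<omega>))"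
        if "\<omega> \<in> A c" for \<omega>
        using that by (intro PU_NSL_cong) (auto simp: A_def)
      then show ?thesis
        using measurable_space[OF X] by (auto simp: A_def B_def)
    qed
    have restr: "restrict (\<lambda>i. m i \<omega>) {1..n} \<in> C" "\<omega> \<in> A (restrict (\<lambda>i. m i \<omega>) {1..n})"
      if "\<omega> \<in> space P" for \<omega>
      using that by (auto simp: A_def C_def)
    \<comment> \<open>Measurability of the urn event comes from the same countable split.\<close>
    have "?E = (\<Union>c\<in>C. A c \<inter> ?E)"
      using restr by blast
    also have "\<dots> = (\<Union>c\<in>C. A c \<inter> (?X -` B c \<inter> space P))"
      by (simp only: AE')
    also have "\<dots> \<in> sets P"
      using C XB AP by (intro sets.countable_UN') auto
    finally have E: "?E \<in> sets P" .

    have "AE \<omega> in P. prob_given P F (PA -` {G} \<inter> space P) \<omega> = measure (measure_pmf (PA_D G0 \<delta> (\<lambda>i. m i \<omega>) n)) {G}"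
      using assms(13) unfolding has_cond_law_def F_def by auto
    moreover have "AE \<omega> in P. \<forall>c\<in>C. prob_given P F (?X -` B c \<inter> space P) \<omega> =
        measure (urn_law G0 \<delta> (\<lambda>i. m i \<omega>)) (B c)"
      using assms(14) B C unfolding has_cond_law_def F_def by (subst AE_ball_countable) auto
    moreover have "AE \<omega> in P. \<forall>c\<in>C. \<omega> \<in> A c \<longrightarrow>
        prob_given P F ?E \<omega> = prob_given P F (?X -` B c \<inter> space P) \<omega>"
      using C prob_given_cong_on[OF A E XB AE'] by (subst AE_ball_countable) auto
    ultimately show ?thesis
      using admissible
    proof eventually_elim
      case (elim \<omega>)
      \<comment> \<open>For each outcome the case is chosen by its own out-degrees; there the
        identity for a deterministic sequence applies.\<close>
      let ?c = "restrict (\<lambda>i. m i \<omega>) {1..n}" and ?m = "\<lambda>i. m i \<omega>"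
      interpret admissible_urn G0 ?m \<delta> using elim by simp
      have space: "space (urn_law G0 \<delta> ?m) = space ?N"
        by (simp add: urn_law_def space_pair_measure space_PiM sets_eq_imp_space_eq[OF sets_psi_law])
      have "B ?c = {x \<in> space (urn_law G0 \<delta> ?m). PU_NSL G0 n ?m (fst x) (snd x) = G}"
        unfolding B_def space by (intro Collect_cong conj_cong refl arg_cong2[where f = "(=)"] PU_NSL_cong) auto
      then have "measure (urn_law G0 \<delta> ?m) (B ?c) = pmf (PA_D G0 \<delta> ?m n) G"
        using measure_PU_NSL_eq_pmf_PA_D[OF assms(12), of G] by simp
      moreover have "PA -` {G} \<inter> space P = {\<omega>' \<in> space P. PA \<omega>' = G}" by auto
      ultimately show ?case
        using elim restr[of \<omega>] by (simp add: pmf.rep_eq)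
    qed
  qed
  then have "AE \<omega> in P. \<forall>G. prob_given P F {\<omega>' \<in> space P. PA \<omega>' = G} \<omega> =
      prob_given P F {\<omega>' \<in> space P. PU_NSL G0 n (\<lambda>i. m i \<omega>') (\<lambda>v. \<psi> v \<omega>') (\<lambda>s. U s \<omega>') = G} \<omega>"
    by (rule AE_all_multigraphs)
  then show ?thesis
    unfolding F_def by eventually_elim auto
qed

end
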